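(* Let $n, r \in \mathbb{N}$ with $n > 2r$. The skewed $r$-random to top shuffle on $\mathrm{Sym}_n$ induces a time-homogeneous Markov chain $M$ on the double cosets $H \backslash \mathrm{Sym}_n / H$, where $H = \mathrm{Sym}_r \times \mathrm{Sym}_{n-r}$; identify these double cosets with the types $\{0,1,\ldots,r\}$. The chain $M$ is irreducible, recurrent, reversible and ergodic. The transition matrix of $M$ has the anti-diagonal eigenvalue property, and its eigenvalues are \[ \frac{(-1)^{r-x}\binom{r}{x}}{\binom{n-r}{r-x}}, \qquad x \in \{0,1,\ldots,r\}. \] Its unique invariant distribution $\pi_x$ is proportional to $\binom{a}{r-x}\binom{a+b}{x}$ where $a = r$ and $b = n-2r$, that is, to $\binom{r}{r-x}\binom{n-r}{x}$, for $x \in \{0,1,\ldots,r\}$, and the scaling factor is $\binom{2a+b}{r} = \binom{n}{r}$. In particular, the second largest eigenvalue in absolute value of the transition matrix is $-\dfrac{r}{n-r}$.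
   Context: Permutations in $\mathrm{Sym}_n$ act on the right on $\{1,\ldots,n\}$, and are composed accordingly. Skewed $r$-random to top shuffle: in a deck of $n$ cards with positions ordered from $1$ at the top to $n$ at the bottom, $r$ cards lying strictly beneath position $r$ are chosen uniformly at random and brought to the top of the deck, maintaining their order. Thus for each $r$-subset $R$ of $\{r+1,\ldots,n\}$ let $d_R \in \mathrm{Sym}_n$ be the permutation of positions that maps $R$ to $\{1,\ldots,r\}$ preserving order, and maps $\{1,\ldots,n\}\setminus R$ to $\{r+1,\ldots,n\}$ preserving order, and let $D$ be the set of all such $d_R$. The shuffle is the random walk on $\mathrm{Sym}_n$ that moves from $g$ to $gd$ with $d$ chosen uniformly at random from $D$. $H = \mathrm{Sym}_r \times \mathrm{Sym}_{n-r}$ is the stabiliser in $\mathrm{Sym}_n$ of $(\{1,\ldots,r\},\{r+1,\ldots,n\})$. The double cosets in $H\backslash \mathrm{Sym}_n/H$ are indexed by $\{0,1,\ldots,r\}$: $g$ has type $x$ (i.e. lies in the double coset indexed by $x$) if and only if $\{1,\ldots,r\}g \cap \{1,\ldots,r\}$ has size $x$. "Induces a time-homogeneous Markov chain" is meant in the strong sense: for every initial distribution of the walk on $\mathrm{Sym}_n$, the process of double cosets visited under $g \mapsto HgH$ is a time-homogeneous Markov chain, with transition probabilities not depending on the initial distribution. Reversible means that the transition matrix $Q$ satisfies the detailed balance equations $\pi_x Q_{xy} = \pi_y Q_{yx}$ for all $x, y$, where $\pi$ is the invariant distribution. Anti-diagonal eigenvalue property: a square matrix $A$ with rows and columns indexed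 by $\{0,1,\ldots,r\}$, with $(0,0)$ in the bottom right, has this property if $A_{ij} = 0$ whenever $i + j > r$ (entries strictly to the left of the anti-diagonal are zero), and the eigenvalues of $A$ are $(-1)^j A_{j(r-j)}$ for $j \in \{0,1,\ldots,r\}$.
   Formalization: The invariant weight C(r,r-x)C(n-r,x)/C(n,r) is attached to the double coset of type r-x instead of x, and the anti-diagonal eigenvalues are read as (-1)^j A_{(r-j)j} instead of (-1)^j A_{j(r-j)}; as printed both fail for n=3, r=1. The last claim is for r ≥ 1. *)

theory Defs
  imports
    "HOL-Probability.Probability"
    "HOL-Combinatorics.Permutations"
    "Jordan_Normal_Form.Char_Poly"
begin

section \<open>The skewed random to top shuffle\<close>

definition sym_grp :: "nat \<Rightarrow> (nat \<Rightarrow> nat) set" where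
  "sym_grp n = {g. g permutes {1..n}}"

text \<open>
  Permutations act on the right: the image of a point \<open>i\<close> under \<open>g\<close> (written \<open>ig\<close>) is
  \<open>g i\<close>, so the product \<open>gh\<close> means first \<open>g\<close>, then \<open>h\<close>.
\<close>
definition perm_mult :: "(nat \<Rightarrow> nat) \<Rightarrow> (nat \<Rightarrow> nat) \<Rightarrow> nat \<Rightarrow> nat" where
  "perm_mult g h = h \<circ> g"

text \<open>
  The set of all \<open>d\<^sub>R\<close>; since \<open>d\<close> permutes \<open>{1..n}\<close>, it maps
  \<open>{1..n} - R\<close> onto \<open>{r+1..n}\<close>.
\<close>
definition skewed_moves :: "nat \<Rightarrow> nat \<Rightarrow> (nat \<Rightarrow> nat) set" where
  "skewed_moves n r = {d \<in> sym_grp n. \<exists>R \<subseteq> {r + 1..n}. card R = r \<and>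
      d ` R = {1..r} \<and> strict_mono_on R d \<and> strict_mono_on ({1..n} - R) d}"

definition young_subgroup :: "nat \<Rightarrow> nat \<Rightarrow> (nat \<Rightarrow> nat) set" where
  "young_subgroup n r = {h \<in> sym_grp n. h ` {1..r} = {1..r} \<and> h ` {r + 1..n} = {r + 1..n}}"

definition double_coset :: "nat \<Rightarrow> nat \<Rightarrow> (nat \<Rightarrow> nat) \<Rightarrow> (nat \<Rightarrow> nat) set" where
  "double_coset n r g =
     {perm_mult (perm_mult h g) k | h k. h \<in> young_subgroup n r \<and> k \<in> young_subgroup n r}"

definition double_cosets :: "nat \<Rightarrow> nat \<Rightarrow> (nat \<Rightarrow> nat) set set" where
  "double_cosets n r = double_coset n r ` sym_grp n"

definition perm_type :: "nat \<Rightarrow> (nat \<Rightarrow> nat) \<Rightarrow> nat" where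
  "perm_type r g = card (g ` {1..r} \<inter> {1..r})"

definition coset_type :: "nat \<Rightarrow> (nat \<Rightarrow> nat) set \<Rightarrow> nat" where
  "coset_type r C = (THE x. \<forall>g \<in> C. perm_type r g = x)"

text \<open>
  The canonical realisation of the walk: an outcome consists of an initial permutation with
  distribution \<open>\<mu>\<close> and an independent sequence of independent uniform moves.
\<close>
definition shuffle_space ::
    "nat \<Rightarrow> nat \<Rightarrow> (nat \<Rightarrow> nat) measure \<Rightarrow> ((nat \<Rightarrow> nat) \<times> (nat \<Rightarrow> nat) stream) measure" where
  "shuffle_space n r \<mu> = \<mu> \<Otimes>\<^sub>M stream_space (uniform_count_measure (skewed_moves n r))"

primrec shuffle_walk :: "nat \<Rightarrow> (nat \<Rightarrow> nat) \<times> (nat \<Rightarrow> nat) stream \<Rightarrow> nat \<Rightarrow> nat" where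
  "shuffle_walk 0 \<omega> = fst \<omega>"
| "shuffle_walk (Suc t) \<omega> = perm_mult (shuffle_walk t \<omega>) (snd \<omega> !! t)"


section \<open>Finite Markov chains\<close>

text \<open>
  The process \<open>X\<close> on the probability space \<open>M\<close> is a time-homogeneous Markov chain on the
  finite state space \<open>S\<close> with transition probabilities \<open>P\<close>.
\<close>
definition markov_chain ::
    "'a measure \<Rightarrow> 's set \<Rightarrow> ('s \<Rightarrow> 's \<Rightarrow> real) \<Rightarrow> (nat \<Rightarrow> 'a \<Rightarrow> 's) \<Rightarrow> bool" where
  "markov_chain M S P X \<longleftrightarrow>
     prob_space M \<and> finite S \<and> (\<forall>t. X t \<in> measurable M (count_space S)) \<and>
     (\<forall>x \<in> S. (\<forall>y \<in> S. 0 \<le> P x y) \<and> (\<Sum>y\<in>S. P x y) = 1) \<and>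
     (\<forall>t s. (\<forall>i \<le> Suc t. s i \<in> S) \<longrightarrow>
        \<P>(\<omega> in M. \<forall>i \<le> t. X i \<omega> = s i) \<noteq> 0 \<longrightarrow>
        \<P>(\<omega> in M. X (Suc t) \<omega> = s (Suc t) \<bar> \<forall>i \<le> t. X i \<omega> = s i) = P (s t) (s (Suc t)))"

text \<open>
  In the remaining definitions \<open>Q\<close> is the transition matrix of a chain on
  \<open>{..<dim_row Q}\<close>, with entry \<open>(x, y)\<close> the probability of a step from \<open>x\<close> to \<open>y\<close>.
\<close>
definition irreducible_chain :: "real mat \<Rightarrow> bool" where
  "irreducible_chain Q \<longleftrightarrow> (\<forall>x < dim_row Q. \<forall>y < dim_row Q. \<exists>t. (Q ^\<^sub>m t) $$ (x, y) > 0)"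

text \<open>
  \<open>first_passage Q y t x\<close> is the probability that the chain started at \<open>x\<close> visits \<open>y\<close> at
  time \<open>t > 0\<close>, and at no earlier time except possibly \<open>0\<close>.
\<close>
fun first_passage :: "real mat \<Rightarrow> nat \<Rightarrow> nat \<Rightarrow> nat \<Rightarrow> real" where
  "first_passage Q y 0 x = 0"
| "first_passage Q y (Suc 0) x = Q $$ (x, y)"
| "first_passage Q y (Suc (Suc t)) x =
     (\<Sum>z \<in> {..<dim_row Q} - {y}. Q $$ (x, z) * first_passage Q y (Suc t) z)"

definition recurrent_state :: "real mat \<Rightarrow> nat \<Rightarrow> bool" where
  "recurrent_state Q x \<longleftrightarrow> (\<lambda>t. first_passage Q x t x) sums 1"

definition finite_mean_return_time :: "real mat \<Rightarrow> nat \<Rightarrow> bool" where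
  "finite_mean_return_time Q x \<longleftrightarrow> summable (\<lambda>t. real t * first_passage Q x t x)"

definition aperiodic_state :: "real mat \<Rightarrow> nat \<Rightarrow> bool" where
  "aperiodic_state Q x \<longleftrightarrow> Gcd {t. 0 < t \<and> (Q ^\<^sub>m t) $$ (x, x) > 0} = 1"

definition recurrent_chain :: "real mat \<Rightarrow> bool" where
  "recurrent_chain Q \<longleftrightarrow> (\<forall>x < dim_row Q. recurrent_state Q x)"

definition ergodic_chain :: "real mat \<Rightarrow> bool" where
  "ergodic_chain Q \<longleftrightarrow>
     (\<forall>x < dim_row Q. recurrent_state Q x \<and> finite_mean_return_time Q x \<and> aperiodic_state Q x)"

definition invariant_distribution :: "real mat \<Rightarrow> real vec \<Rightarrow> bool" where
  "invariant_distribution Q p \<longleftrightarrow>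
     p \<in> carrier_vec (dim_row Q) \<and>
     (\<forall>x < dim_row Q. 0 \<le> vec_index p x) \<and> (\<Sum>x<dim_row Q. vec_index p x) = 1 \<and>
     (\<forall>y < dim_row Q. (\<Sum>x<dim_row Q. vec_index p x * Q $$ (x, y)) = vec_index p y)"

definition detailed_balance :: "real mat \<Rightarrow> real vec \<Rightarrow> bool" where
  "detailed_balance Q p \<longleftrightarrow>
     (\<forall>x < dim_row Q. \<forall>y < dim_row Q. vec_index p x * Q $$ (x, y) = vec_index p y * Q $$ (y, x))"

definition reversible_chain :: "real mat \<Rightarrow> bool" where
  "reversible_chain Q \<longleftrightarrow> (\<exists>p. invariant_distribution Q p \<and> detailed_balance Q p)"


section \<open>Eigenvalues\<close>

text \<open>
  Real eigenvalues with algebraic multiplicity. An equation between this multiset and one of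
  size \<open>dim_row A\<close> also says that there are no non-real eigenvalues.
\<close>
definition eigenvalue_mset :: "real mat \<Rightarrow> real multiset" where
  "eigenvalue_mset A = proots (char_poly A)"

text \<open>
  Rows and columns are indexed by \<open>{0..r}\<close> and displayed with \<open>(0, 0)\<close> in the bottom right.
  The sign \<open>(-1)^j\<close> goes with the \<open>j\<close>th row of the display counted from \<open>0\<close> at the top, which
  is the row with index \<open>r - j\<close>; so the entry in the top right, \<open>A $$ (r, 0)\<close>, is an
  eigenvalue, and the signs alternate downwards along the anti-diagonal.
  (Attaching the sign to the row with index \<open>j\<close> instead would negate all these numbers for odd \<open>r\<close>,
  and a stochastic matrix with \<open>A $$ (r, 0) = 1\<close> would have to have the eigenvalue \<open>-1\<close>.)
\<close>
definition anti_diagonal_eigenvalue_property :: "nat \<Rightarrow> real mat \<Rightarrow> bool" where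
  "anti_diagonal_eigenvalue_property r A \<longleftrightarrow>
     A \<in> carrier_mat (Suc r) (Suc r) \<and>
     (\<forall>i \<le> r. \<forall>j \<le> r. i + j > r \<longrightarrow> A $$ (i, j) = 0) \<and>
     eigenvalue_mset A = image_mset (\<lambda>j. (-1) ^ j * A $$ (r - j, j)) (mset_set {0..r})"

definition second_largest_abs_eigenvalue :: "real mat \<Rightarrow> real \<Rightarrow> bool" where
  "second_largest_abs_eigenvalue A b \<longleftrightarrow>
     (\<exists>a N. eigenvalue_mset A = add_mset a (add_mset b N) \<and>
        \<bar>b\<bar> < \<bar>a\<bar> \<and> (\<forall>c \<in># N. \<bar>c\<bar> < \<bar>b\<bar>))"

end

theory Submission
  imports Defs
begin

text \<open>
  If the image \<open>A\<close> of \<open>{1..r}\<close> under \<open>g\<close> has \<open>x\<close> points in \<open>{1..r}\<close>, then \<open>gd\<^sub>R\<close> has type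
  \<open>card (A \<inter> R)\<close>, whose law is hypergeometric and depends on \<open>g\<close> only through \<open>x\<close>. The
  \<open>k\<close>th binomial moment of this law is a multiple of \<open>(r - x) choose k\<close>, a polynomial in \<open>x\<close>
  of degree \<open>k\<close>, so the transition operator is triangular in the basis of the functions
  \<open>x \<mapsto> x choose k\<close> and its eigenvalues can be read off. As \<open>n > 2r\<close>, the entries of the
  transition matrix on the anti-diagonal and next to it (\<open>x + y = r\<close> and \<open>x + y = r - 1\<close>) are
  positive, hence some power of it is positive; recurrence, ergodicity and uniqueness of the
  invariant distribution follow, and detailed balance identifies that distribution.
\<close>

section \<open>Finite chains with a positive power\<close>

locale stochastic_chain =
  fixes Q :: "real mat" and k :: nat
  assumes carrier: "Q \<in> carrier_mat k k"
    and nonneg: "\<And>x y. x < k \<Longrightarrow> y < k \<Longrightarrow> 0 \<le> Q $$ (x, y)"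
    and row_sum: "\<And>x. x < k \<Longrightarrow> (\<Sum>y<k. Q $$ (x, y)) = 1"
begin

lemma dim_Q [simp]: "dim_row Q = k" "dim_col Q = k"
  using carrier by auto

lemma pow_carrier: "Q ^\<^sub>m t \<in> carrier_mat k k"
  using carrier by simp

lemma pow_Suc_entry:
  assumes "x < k" "y < k"
  shows "(Q ^\<^sub>m Suc t) $$ (x, y) = (\<Sum>z<k. (Q ^\<^sub>m t) $$ (x, z) * Q $$ (z, y))"
  using assms by (simp add: scalar_prod_def lessThan_atLeast0)

text \<open>\<open>pow_mat\<close> adds the new factor on the right; arguments that condition on the
  first step need it on the left.\<close>

lemma pow_Suc_commute: "Q ^\<^sub>m Suc t = Q * Q ^\<^sub>m t"
proof (induction t)
  case (Suc t)
  then have "Q ^\<^sub>m Suc (Suc t) = Q * Q ^\<^sub>m t * Q"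
    by simp
  also have "\<dots> = Q * (Q ^\<^sub>m t * Q)"
    using carrier pow_carrier by (intro assoc_mult_mat) auto
  finally show ?case by simp
qed (use carrier in auto)

lemma pow_Suc_entry':
  assumes "x < k" "y < k"
  shows "(Q ^\<^sub>m Suc t) $$ (x, y) = (\<Sum>z<k. Q $$ (x, z) * (Q ^\<^sub>m t) $$ (z, y))"
  unfolding pow_Suc_commute using assms by (simp add: scalar_prod_def lessThan_atLeast0)

lemma pow_nonneg: "x < k \<Longrightarrow> y < k \<Longrightarrow> 0 \<le> (Q ^\<^sub>m t) $$ (x, y)"
proof (induction t arbitrary: y)
  case (Suc t)
  then show ?case
    unfolding pow_Suc_entry[OF Suc.prems] by (intro sum_nonneg mult_nonneg_nonneg nonneg) auto
qed (auto simp: one_mat_def)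

text \<open>Row \<open>x\<close> sums to 1, so some first step \<open>x\<close> to \<open>z\<close>
  has positive probability, and from \<open>z\<close> every state can be reached in \<open>t\<close>
  steps. Thus a positive power is followed by another positive power.\<close>

lemma pow_Suc_pos:
  assumes pos: "\<And>x y. x < k \<Longrightarrow> y < k \<Longrightarrow> 0 < (Q ^\<^sub>m t) $$ (x, y)" and xy: "x < k" "y < k"
  shows "0 < (Q ^\<^sub>m Suc t) $$ (x, y)"
proof -
  have "\<exists>z<k. Q $$ (x, z) \<noteq> 0"
    using row_sum[OF xy(1)] by (metis lessThan_iff sum.neutral zero_neq_one)
  then obtain z where z: "z < k" "Q $$ (x, z) > 0"
    using nonneg[OF xy(1)] by force
  have "0 < Q $$ (x, z) * (Q ^\<^sub>m t) $$ (z, y)"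
    using z pos xy by simp
  also have "\<dots> \<le> (\<Sum>z<k. Q $$ (x, z) * (Q ^\<^sub>m t) $$ (z, y))"
    using z xy by (intro member_le_sum mult_nonneg_nonneg nonneg pow_nonneg) auto
  finally show ?thesis
    by (simp only: pow_Suc_entry'[OF xy])
qed

lemma pow_step_pos:
  assumes "x < k" "y < k" "z < k" "0 < (Q ^\<^sub>m t) $$ (x, z)" "0 < Q $$ (z, y)"
  shows "0 < (Q ^\<^sub>m Suc t) $$ (x, y)"
proof -
  have "0 < (Q ^\<^sub>m t) $$ (x, z) * Q $$ (z, y)"
    using assms by simp
  also have "\<dots> \<le> (\<Sum>z<k. (Q ^\<^sub>m t) $$ (x, z) * Q $$ (z, y))"
    using assms by (intro member_le_sum mult_nonneg_nonneg nonneg pow_nonneg) auto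
  finally show ?thesis
    by (simp only: pow_Suc_entry[OF assms(1,2)])
qed

text \<open>The probability that the chain started at \<open>x\<close> avoids \<open>y\<close> at the times \<open>1, \<dots>, t\<close>.\<close>
primrec avoid :: "nat \<Rightarrow> nat \<Rightarrow> nat \<Rightarrow> real" where
  "avoid y 0 x = 1"
| "avoid y (Suc t) x = (\<Sum>z \<in> {..<k} - {y}. Q $$ (x, z) * avoid y t z)"

text \<open>The first visit to \<open>y\<close> falls on time \<open>Suc t\<close> when
  \<open>y\<close> is avoided up to \<open>t\<close> but not up to \<open>Suc t\<close>. This form
  makes sums of first-passage probabilities telescope.\<close>

lemma first_passage_eq_avoid_diff:
  assumes "x < k" "y < k"
  shows "first_passage Q y (Suc t) x = avoid y t x - avoid y (Suc t) x"
  using assms(1)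
proof (induction t arbitrary: x)
  case 0
  then show ?case
    using row_sum[of x] assms(2) by (simp add: sum.remove[of "{..<k}" y])
next
  case (Suc t)
  have "first_passage Q y (Suc (Suc t)) x
      = (\<Sum>z \<in> {..<k} - {y}. Q $$ (x, z) * (avoid y t z - avoid y (Suc t) z))"
    using Suc.IH by (auto intro!: sum.cong)
  then show ?case
    by (simp add: right_diff_distrib sum_subtractf)
qed

lemma avoid_nonneg: "x < k \<Longrightarrow> 0 \<le> avoid y t x"
  by (induction t arbitrary: x) (auto intro!: sum_nonneg mult_nonneg_nonneg nonneg)

lemma first_passage_nonneg: "x < k \<Longrightarrow> y < k \<Longrightarrow> 0 \<le> first_passage Q y (Suc t) x"
  by (induction t arbitrary: x) (auto intro!: sum_nonneg mult_nonneg_nonneg nonneg)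

text \<open>The Markov property at time \<open>t\<close>: wherever the chain is then, avoiding
  \<open>y\<close> for \<open>s\<close> further steps has probability at most
  \<open>c\<close>.\<close>

lemma avoid_plus_le:
  assumes "\<And>z. z < k \<Longrightarrow> avoid y s z \<le> c" and "x < k"
  shows "avoid y (t + s) x \<le> avoid y t x * c"
  using assms(2)
proof (induction t arbitrary: x)
  case (Suc t)
  then show ?case
    by (auto simp: sum_distrib_right mult.assoc intro!: sum_mono mult_left_mono nonneg)
qed (use assms in auto)

text \<open>Being at \<open>y\<close> at time \<open>Suc t\<close> and avoiding \<open>y\<close> up
  to that time are disjoint events. As the chain is given only by its matrix here, the proof
  conditions on the first step.\<close>

lemma pow_plus_avoid_le:
  assumes "x < k" "y < k"
  shows "(Q ^\<^sub>m Suc t) $$ (x, y) + avoid y (Suc t) x \<le> 1"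
  using assms(1)
proof (induction t arbitrary: x)
  case 0
  have "Q ^\<^sub>m Suc 0 = Q" using carrier by simp
  then show ?case
    using row_sum[OF 0] assms(2) by (simp add: sum.remove[of "{..<k}" y])
next
  case (Suc t)
  \<comment> \<open>A first step to \<open>y\<close> contributes nothing to the avoidance term, so
    the summand \<open>z = y\<close> is bounded separately.\<close>
  have le1: "(Q ^\<^sub>m Suc t) $$ (y, y) \<le> 1"
    using Suc.IH[OF assms(2)] avoid_nonneg[of y y "Suc t"] assms(2) by linarith
  have "(Q ^\<^sub>m Suc (Suc t)) $$ (x, y) + avoid y (Suc (Suc t)) x
     = (\<Sum>z<k. Q $$ (x, z) * (Q ^\<^sub>m Suc t) $$ (z, y))
       + (\<Sum>z \<in> {..<k} - {y}. Q $$ (x, z) * avoid y (Suc t) z)"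
    using pow_Suc_entry'[OF Suc.prems assms(2), of "Suc t"] by simp
  also have "\<dots> = Q $$ (x, y) * (Q ^\<^sub>m Suc t) $$ (y, y)
       + (\<Sum>z \<in> {..<k} - {y}. Q $$ (x, z) * ((Q ^\<^sub>m Suc t) $$ (z, y) + avoid y (Suc t) z))"
    using assms(2) by (simp add: sum.remove[of "{..<k}" y] distrib_left sum.distrib del: avoid.simps pow_mat.simps)
  also have "\<dots> \<le> Q $$ (x, y) * 1 + (\<Sum>z \<in> {..<k} - {y}. Q $$ (x, z) * 1)"
    using Suc le1 assms(2) nonneg by (intro add_mono sum_mono mult_left_mono) auto
  also have "\<dots> = 1"
    using row_sum[OF Suc.prems] assms(2) by (simp add: sum.remove[of "{..<k}" y])
  finally show ?case .
qed

lemma invariant_pow: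
  assumes inv: "\<And>y. y < k \<Longrightarrow> (\<Sum>x<k. v x * Q $$ (x, y)) = v y" and "y < k"
  shows "(\<Sum>x<k. v x * (Q ^\<^sub>m t) $$ (x, y)) = v y"
  using assms(2)
proof (induction t arbitrary: y)
  case 0
  have "(\<Sum>x<k. v x * (Q ^\<^sub>m 0) $$ (x, y)) = (\<Sum>x<k. if x = y then v x else 0)"
    using 0 by (intro sum.cong) auto
  with 0 show ?case by simp
next
  case (Suc t)
  have "(\<Sum>x<k. v x * (Q ^\<^sub>m Suc t) $$ (x, y))
      = (\<Sum>x<k. \<Sum>z<k. v x * (Q ^\<^sub>m t) $$ (x, z) * Q $$ (z, y))"
    using Suc.prems
    by (intro sum.cong refl) (simp only: pow_Suc_entry lessThan_iff sum_distrib_left mult.assoc)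
  also have "\<dots> = (\<Sum>z<k. (\<Sum>x<k. v x * (Q ^\<^sub>m t) $$ (x, z)) * Q $$ (z, y))"
    by (subst sum.swap) (simp add: sum_distrib_right)
  also have "\<dots> = v y"
    using Suc inv by simp
  finally show ?case .
qed

lemma invariant_of_detailed_balance:
  assumes "detailed_balance Q p" "y < k"
  shows "(\<Sum>x<k. vec_index p x * Q $$ (x, y)) = vec_index p y"
proof -
  have "(\<Sum>x<k. vec_index p x * Q $$ (x, y)) = (\<Sum>x<k. vec_index p y * Q $$ (y, x))"
    using assms by (intro sum.cong) (auto simp: detailed_balance_def)
  then show ?thesis
    using row_sum[OF assms(2)] by (simp flip: sum_distrib_left)
qed

end

section \<open>Primitive stochastic matrices: ergodicity and uniqueness of the invariant
  distribution\<close>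

locale positive_power_chain = stochastic_chain +
  fixes m :: nat
  assumes m_pos: "0 < m"
    and pow_pos: "\<And>x y. x < k \<Longrightarrow> y < k \<Longrightarrow> 0 < (Q ^\<^sub>m m) $$ (x, y)"
begin

lemma irreducible: "irreducible_chain Q"
  unfolding irreducible_chain_def using pow_pos by auto

text \<open>Returns are possible at the consecutive times \<open>m\<close> and \<open>Suc m\<close>,
  which are coprime.\<close>

lemma aperiodic:
  assumes "x < k"
  shows "aperiodic_state Q x"
proof -
  let ?S = "{t. 0 < t \<and> (Q ^\<^sub>m t) $$ (x, x) > 0}"
  have "m \<in> ?S" "Suc m \<in> ?S"
    using m_pos pow_pos pow_Suc_pos[OF pow_pos] assms by auto
  then have "Gcd ?S dvd m" "Gcd ?S dvd Suc m"
    by (simp_all add: Gcd_dvd)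
  then have "Gcd ?S dvd 1"
    by (metis Suc_eq_plus1 dvd_add_right_iff)
  then show ?thesis
    by (simp add: aperiodic_state_def)
qed

text \<open>From every state, \<open>y\<close> is occupied after \<open>m\<close> steps with
  probability more than \<epsilon>, so each block of \<open>m\<close> steps multiplies the avoidance
  probability by at most 1 - \<epsilon>.\<close>

lemma avoid_geometric_decay:
  assumes "y < k"
  obtains C \<rho> where "0 \<le> C" "0 \<le> \<rho>" "\<rho> < 1" "\<And>t x. x < k \<Longrightarrow> avoid y t x \<le> C * \<rho> ^ t"
proof -
  \<comment> \<open>Halving the minimum keeps 1 - \<epsilon> positive even if every entry is 1 (the
    case \<open>k = 1\<close>); \<rho> is then positive and can be divided by.\<close>
  define \<epsilon> where "\<epsilon> = Min ((\<lambda>x. (Q ^\<^sub>m m) $$ (x, y)) ` {..<k}) / 2"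
  have "0 < Min ((\<lambda>x. (Q ^\<^sub>m m) $$ (x, y)) ` {..<k})"
    using assms pow_pos by (subst Min_gr_iff) auto
  then have \<epsilon>_pos: "0 < \<epsilon>" by (simp add: \<epsilon>_def)
  have \<epsilon>_less: "\<epsilon> < (Q ^\<^sub>m m) $$ (x, y)" if "x < k" for x
  proof -
    have "2 * \<epsilon> \<le> (Q ^\<^sub>m m) $$ (x, y)"
      using that by (simp add: \<epsilon>_def)
    with \<epsilon>_pos show ?thesis by linarith
  qed
  obtain m' where m': "m = Suc m'"
    using m_pos by (cases m) auto
  have avoid_m: "avoid y m x \<le> 1 - \<epsilon>" if "x < k" for x
    using \<epsilon>_less[OF that] pow_plus_avoid_le[OF that assms, of m'] by (simp only: m')
  have \<epsilon>_less_1: "0 < 1 - \<epsilon>"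
    using \<epsilon>_less[OF assms] pow_plus_avoid_le[OF assms assms, of m'] avoid_nonneg[OF assms, of y m]
    by (simp only: m')
  have step: "avoid y (q * m + s) x \<le> (1 - \<epsilon>) ^ q * 1" if "x < k" for q s x
    using that
  proof (induction q arbitrary: x)
    case 0
    have "avoid y s x \<le> 1" if "x < k" for x
      using that
    proof (induction s arbitrary: x)
      case (Suc s)
      then have "avoid y (Suc s) x \<le> (\<Sum>z \<in> {..<k} - {y}. Q $$ (x, z) * 1)"
        unfolding avoid.simps by (intro sum_mono mult_left_mono nonneg) auto
      also have "\<dots> \<le> (\<Sum>z<k. Q $$ (x, z))"
        using Suc.prems nonneg by (auto intro!: sum_mono2)
      finally show ?case using row_sum[OF Suc.prems] by simp
    qed simp
    with 0 show ?case by simp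
  next
    case (Suc q)
    have "avoid y (m + (q * m + s)) x \<le> avoid y m x * (1 - \<epsilon>) ^ q"
      using Suc by (intro avoid_plus_le) auto
    also have "\<dots> \<le> (1 - \<epsilon>) * (1 - \<epsilon>) ^ q"
      using \<epsilon>_less_1 avoid_m[OF Suc.prems] by (intro mult_right_mono) auto
    finally show ?case by (simp add: add_ac)
  qed
  \<comment> \<open>The \<open>m\<close>-th root turns decay per block into decay per step; the
    constant \<open>1 / \<rho> ^ m\<close> pays for the last, incomplete block.\<close>
  define \<rho> where "\<rho> = root m (1 - \<epsilon>)"
  have \<rho>: "0 < \<rho>" "\<rho> < 1" "\<rho> ^ m = 1 - \<epsilon>"
    using m_pos \<epsilon>_pos \<epsilon>_less_1 by (auto simp: \<rho>_def)
  show ?thesis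
  proof
    show "avoid y t x \<le> (1 / \<rho> ^ m) * \<rho> ^ t" if "x < k" for t x
    proof -
      have "avoid y t x \<le> (1 - \<epsilon>) ^ (t div m)"
        using step[OF that, of "t div m" "t mod m"] by simp
      also have "\<dots> = (1 / \<rho> ^ m) * \<rho> ^ (m * (t div m) + m)"
        using \<rho>(3) \<epsilon>_less_1 by (simp add: power_add power_mult)
      also have "\<dots> \<le> (1 / \<rho> ^ m) * \<rho> ^ t"
        using \<rho> m_pos \<epsilon>_less_1
        by (intro mult_left_mono power_decreasing)
          (auto, metis add.commute add_le_cancel_left less_imp_le_nat mod_less_divisor mult_div_mod_eq)
      finally show ?thesis .
    qed
  qed (use \<rho> \<epsilon>_less_1 in auto)
qed

lemma avoid_tendsto_0:
  assumes "x < k" "y < k"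
  shows "(\<lambda>t. avoid y t x) \<longlonglongrightarrow> 0"
proof -
  obtain C \<rho> where *: "0 \<le> \<rho>" "\<rho> < 1" "\<And>t x. x < k \<Longrightarrow> avoid y t x \<le> C * \<rho> ^ t"
    by (rule avoid_geometric_decay[OF assms(2)]) blast
  have "(\<lambda>t. C * \<rho> ^ t) \<longlonglongrightarrow> C * 0"
    using * by (intro tendsto_intros LIMSEQ_realpow_zero) auto
  then have "(\<lambda>t. C * \<rho> ^ t) \<longlonglongrightarrow> 0" by simp
  then show ?thesis
    by (rule Lim_null_comparison[rotated])
      (use * avoid_nonneg assms in \<open>auto simp: abs_of_nonneg\<close>)
qed

text \<open>The first-passage probabilities telescope to 1 minus the limit of the avoidance
  probabilities, which is 0. The term at time 0 is 0, so the index shift is harmless.\<close>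

lemma recurrent:
  assumes "x < k"
  shows "recurrent_state Q x"
proof -
  have "(\<lambda>t. avoid x t x - avoid x (Suc t) x) sums (avoid x 0 x - 0)"
    by (intro telescope_sums' avoid_tendsto_0 assms)
  then have "(\<lambda>t. first_passage Q x (Suc t) x) sums 1"
    by (simp only: first_passage_eq_avoid_diff[OF assms assms] avoid.simps(1) diff_zero)
  then show ?thesis
    unfolding recurrent_state_def by (subst (asm) sums_Suc_iff) simp
qed

text \<open>A first return at \<open>Suc t\<close> requires avoidance up to \<open>t\<close>, so the
  series is dominated by a multiple of the derivative of the geometric series.\<close>

lemma finite_mean_return:
  assumes "x < k"
  shows "finite_mean_return_time Q x"
proof -
  obtain C \<rho> where *: "0 \<le> C" "0 \<le> \<rho>" "\<rho> < 1" "\<And>t x'. x' < k \<Longrightarrow> avoid x t x' \<le> C * \<rho> ^ t"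
    by (rule avoid_geometric_decay[OF assms]) blast
  have "summable (\<lambda>t. C * (real (Suc t) * \<rho> ^ t))"
    using geometric_deriv_sums[of \<rho>] * by (intro summable_mult) (auto simp: sums_iff)
  then have "summable (\<lambda>t. real (Suc t) * first_passage Q x (Suc t) x)"
  proof (rule summable_comparison_test_ev[rotated], intro always_eventually allI)
    fix t
    have "first_passage Q x (Suc t) x \<le> avoid x t x"
      using avoid_nonneg[OF assms, of x "Suc t"] by (simp only: first_passage_eq_avoid_diff[OF assms assms])
    also have "\<dots> \<le> C * \<rho> ^ t" using * assms by simp
    finally have "real (Suc t) * first_passage Q x (Suc t) x \<le> real (Suc t) * (C * \<rho> ^ t)"
      by (intro mult_left_mono) auto
    moreover have "0 \<le> first_passage Q x (Suc t) x"
      using first_passage_nonneg assms by blast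
    ultimately show "norm (real (Suc t) * first_passage Q x (Suc t) x) \<le> C * (real (Suc t) * \<rho> ^ t)"
      by (simp add: abs_mult mult_ac)
  qed
  then show ?thesis
    unfolding finite_mean_return_time_def by (subst (asm) summable_Suc_iff)
qed

lemma recurrent_chain: "recurrent_chain Q"
  by (simp add: recurrent_chain_def recurrent)

lemma ergodic_chain: "ergodic_chain Q"
  by (simp add: ergodic_chain_def recurrent finite_mean_return aperiodic)

text \<open>
  Subtract from \<open>v\<close> the largest multiple of \<open>w\<close> that keeps it nonnegative: the difference is
  invariant and vanishes somewhere, hence everywhere as a power of \<open>Q\<close> is positive.
\<close>
lemma invariant_proportional:
  assumes v: "\<And>y. y < k \<Longrightarrow> (\<Sum>x<k. v x * Q $$ (x, y)) = v y"
    and w: "\<And>y. y < k \<Longrightarrow> (\<Sum>x<k. w x * Q $$ (x, y)) = w y"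
    and w_pos: "\<And>x. x < k \<Longrightarrow> 0 < w x"
  obtains c where "\<And>x. x < k \<Longrightarrow> v x = c * w x"
proof (cases "k = 0")
  case True
  then show ?thesis using that by auto
next
  case False
  define c where "c = Min ((\<lambda>x. v x / w x) ` {..<k})"
  have "c \<in> (\<lambda>x. v x / w x) ` {..<k}"
    unfolding c_def using False by (intro Min_in) auto
  then obtain z where z: "z < k" "c = v z / w z" by auto
  define d where "d x = v x - c * w x" for x
  have "(\<Sum>x<k. d x * Q $$ (x, y)) = d y" if "y < k" for y
    using v[OF that] w[OF that]
    by (simp add: d_def left_diff_distrib sum_subtractf mult.assoc flip: sum_distrib_left)
  then have "(\<Sum>x<k. d x * (Q ^\<^sub>m m) $$ (x, z)) = d z"
    using z by (intro invariant_pow)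
  also have "d z = 0"
    using z w_pos[of z] by (simp add: d_def)
  finally have "(\<Sum>x<k. d x * (Q ^\<^sub>m m) $$ (x, z)) = 0" .
  moreover have "0 \<le> d x" if "x < k" for x
  proof -
    have "c \<le> v x / w x"
      unfolding c_def using that by (intro Min_le) auto
    then show ?thesis using w_pos[OF that] by (simp add: d_def field_simps)
  qed
  ultimately have "d x * (Q ^\<^sub>m m) $$ (x, z) = 0" if "x < k" for x
    using that z pow_nonneg by (subst (asm) sum_nonneg_eq_0_iff) auto
  then have "d x = 0" if "x < k" for x
    using that z pow_pos[of x z] by fastforce
  then show ?thesis
    using that by (auto simp: d_def)
qed

lemma invariant_distribution_unique:
  assumes p: "invariant_distribution Q p" and p': "invariant_distribution Q p'"
    and pos: "\<And>x. x < k \<Longrightarrow> 0 < vec_index p x"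
  shows "p' = p"
proof -
  obtain c where c: "\<And>x. x < k \<Longrightarrow> vec_index p' x = c * vec_index p x"
    by (rule invariant_proportional[of "vec_index p'" "vec_index p"])
      (use p p' pos in \<open>auto simp: invariant_distribution_def\<close>)
  then have "(\<Sum>x<k. vec_index p' x) = c * (\<Sum>x<k. vec_index p x)"
    by (simp add: sum_distrib_left)
  then have "c = 1"
    using p p' by (simp add: invariant_distribution_def)
  with c show ?thesis
    using p p' by (intro eq_vecI) (auto simp: invariant_distribution_def)
qed

end

section \<open>The chain of types\<close>

text \<open>Choosing \<open>y\<close> of \<open>a\<close> points and marking \<open>k\<close> of
  those is the same as marking \<open>k\<close> points first and then choosing the other
  \<open>y - k\<close>; Vandermonde's identity sums over the rest. Up to normalisation this is a
  binomial moment of the hypergeometric law.\<close>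

lemma vandermonde_binomial_moment:
  fixes a b r k :: nat
  assumes "k \<le> r"
  shows "(\<Sum>y\<le>r. (a choose y) * (b choose (r - y)) * (y choose k))
    = (a choose k) * ((a + b - k) choose (r - k))"
proof (cases "k \<le> a")
  case False
  then have "(a choose y) * (b choose (r - y)) * (y choose k) = 0" for y
    by (cases "y \<le> a") (auto simp: binomial_eq_0)
  then have "(\<Sum>y\<le>r. (a choose y) * (b choose (r - y)) * (y choose k)) = 0"
    by (intro sum.neutral) blast
  with False show ?thesis by (simp add: binomial_eq_0)
next
  case True
  have eq: "(a choose y) * (y choose k) = (a choose k) * ((a - k) choose (y - k))" if "k \<le> y" for y
    using that True choose_mult[of k y a] by (cases "y \<le> a") (auto simp: binomial_eq_0)
  have "(\<Sum>y\<le>r. (a choose y) * (b choose (r - y)) * (y choose k))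
      = (\<Sum>y\<in>{k..r}. (a choose y) * (b choose (r - y)) * (y choose k))"
    by (rule sum.mono_neutral_right) auto
  also have "\<dots> = (\<Sum>y\<in>{k..r}. (a choose k) * (((a - k) choose (y - k)) * (b choose (r - y))))"
    by (intro sum.cong) (auto simp: eq mult.assoc mult.left_commute simp flip: mult.assoc)
  also have "\<dots> = (\<Sum>j\<le>r - k. (a choose k) * (((a - k) choose j) * (b choose (r - k - j))))"
    by (rule sum.reindex_bij_witness[of _ "\<lambda>j. j + k" "\<lambda>y. y - k"]) (use assms in \<open>auto simp: add.commute\<close>)
  also have "\<dots> = (a choose k) * ((a + b - k) choose (r - k))"
    using vandermonde[of "a - k" b "r - k"] True by (simp flip: sum_distrib_left)
  finally show ?thesis .
qed

text \<open>Expands a polynomial in \<open>x\<close> of degree \<open>k\<close> in the basis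
  \<open>x choose j\<close>; the coefficients become a column of the triangular matrix of the
  transition operator.\<close>

lemma binomial_diff_expand:
  assumes "x \<le> r"
  shows "real ((r - x) choose k) = (\<Sum>j\<le>k. (-1) ^ j * real (x choose j) * real ((r - j) choose (k - j)))"
  using assms
proof (induction x arbitrary: r k)
  case 0
  have "(\<Sum>j\<le>k. (-1) ^ j * real (0 choose j) * real ((r - j) choose (k - j)))
     = (\<Sum>j\<in>{0}. (-1) ^ j * real (0 choose j) * real ((r - j) choose (k - j)))"
    by (rule sum.mono_neutral_right) auto
  then show ?case by simp
next
  case (Suc x)
  show ?case
  proof (cases k)
    case (Suc l)
    \<comment> \<open>Pascal's rule splits \<open>Suc x choose j\<close>. Shifting the index in the
      second part produces the sum for \<open>r - 1\<close> and \<open>l\<close>, with a minus sign;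
      Pascal's rule for \<open>r - x\<close> then closes the induction.\<close>
    have "(\<Sum>j\<le>k. (-1) ^ j * real (Suc x choose j) * real ((r - j) choose (k - j)))
       = (\<Sum>j\<le>k. (-1) ^ j * real (x choose j) * real ((r - j) choose (k - j)))
         - (\<Sum>j\<le>l. (-1) ^ j * real (x choose j) * real ((r - 1 - j) choose (l - j)))"
      unfolding Suc sum.atMost_Suc_shift
      by (simp add: algebra_simps sum.distrib sum_negf sum_subtractf del: sum.atMost_Suc)
    also have "\<dots> = real ((r - x) choose k) - real ((r - 1 - x) choose l)"
      using Suc.prems Suc.IH[of r k] Suc.IH[of "r - 1" l] by simp
    also have "r - x = Suc (r - Suc x)"
      using Suc.prems by simp
    finally show ?thesis
      by (simp add: Suc)
  qed simp
qed

text \<open>Both sides count the ordered pairs of disjoint subsets of sizes \<open>a\<close> and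
  \<open>b\<close> in a set of size \<open>n\<close>.\<close>

lemma choose_mult_choose_diff:
  fixes n a b :: nat
  shows "(n choose a) * ((n - a) choose b) = (n choose b) * ((n - b) choose a)"
proof (cases "a + b \<le> n")
  case True
  then have "(n choose (a + b)) * ((a + b) choose a) = (n choose a) * ((n - a) choose b)"
    "(n choose (a + b)) * ((a + b) choose b) = (n choose b) * ((n - b) choose a)"
    using choose_mult[of a "a + b" n] choose_mult[of b "a + b" n] by auto
  moreover have "(a + b) choose a = (a + b) choose b"
    using binomial_symmetric[of a "a + b"] by simp
  ultimately show ?thesis by simp
next
  case False
  then have "n - a < b \<or> n < a" "n - b < a \<or> n < b" by auto
  then show ?thesis by (auto simp: binomial_eq_0)
qed

section \<open>The transition matrix of the types and a positive power of it\<close>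

text \<open>
  The number of \<open>r\<close>-subsets of \<open>{r+1..n}\<close> that meet a set of \<open>r - x\<close> of these points in
  exactly \<open>y\<close> points, divided by the number of all \<open>r\<close>-subsets.
\<close>
definition type_mat :: "nat \<Rightarrow> nat \<Rightarrow> real mat" where
  "type_mat n r = mat (Suc r) (Suc r) (\<lambda>(x, y).
     real (((r - x) choose y) * ((n - 2 * r + x) choose (r - y))) / real ((n - r) choose r))"

lemma type_mat_carrier [simp]: "type_mat n r \<in> carrier_mat (Suc r) (Suc r)"
  by (simp add: type_mat_def)

lemma type_mat_entry:
  assumes "x \<le> r" "y \<le> r"
  shows "type_mat n r $$ (x, y) =
    real (((r - x) choose y) * ((n - 2 * r + x) choose (r - y))) / real ((n - r) choose r)"
  using assms by (simp add: type_mat_def)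

lemma type_mat_stochastic:
  assumes "2 * r < n"
  shows "stochastic_chain (type_mat n r) (Suc r)"
proof
  fix x assume x: "x < Suc r"
  have "(\<Sum>y\<le>r. ((r - x) choose y) * ((n - 2 * r + x) choose (r - y))) = (n - r) choose r"
    using vandermonde[of "r - x" "n - 2 * r + x" r] x assms by simp
  then have "(\<Sum>y\<le>r. real (((r - x) choose y) * ((n - 2 * r + x) choose (r - y)))) = real ((n - r) choose r)"
    by (metis of_nat_sum)
  moreover have "(\<Sum>y<Suc r. type_mat n r $$ (x, y))
      = (\<Sum>y\<le>r. real (((r - x) choose y) * ((n - 2 * r + x) choose (r - y)))) / real ((n - r) choose r)"
    using x by (simp add: lessThan_Suc_atMost type_mat_entry sum_divide_distrib)
  ultimately show "(\<Sum>y<Suc r. type_mat n r $$ (x, y)) = 1"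
    using assms by simp
qed (auto simp: type_mat_entry less_Suc_eq_le)

text \<open>No lower index exceeds its upper index: \<open>y \<le> r - x\<close>, and
  \<open>r - y \<le> x + 1 \<le> n - 2 * r + x\<close> because \<open>n - 2 * r\<close> is at least
  1.\<close>

lemma type_mat_pos:
  assumes "2 * r < n" "x + y \<le> r" "r \<le> Suc (x + y)"
  shows "0 < type_mat n r $$ (x, y)"
  using assms by (auto simp: type_mat_entry)

text \<open>Two steps can change the type by -1, 0 or 1, so \<open>2 * t\<close> steps connect types
  at distance at most \<open>t\<close>, and \<open>2 * r\<close> steps connect all of them. One more
  step makes the exponent positive when \<open>r = 0\<close> as well.\<close>

lemma type_mat_positive_power:
  assumes n: "2 * r < n"
  shows "positive_power_chain (type_mat n r) (Suc r) (Suc (2 * r))"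
proof -
  interpret stochastic_chain "type_mat n r" "Suc r"
    by (rule type_mat_stochastic[OF n])
  have even_pos: "0 < (type_mat n r ^\<^sub>m (2 * t)) $$ (x, y)"
    if "x \<le> r" "y \<le> r" "x \<le> y + t" "y \<le> x + t" for x y t
    using that
  proof (induction t arbitrary: y)
    case (Suc t)
    \<comment> \<open>\<open>z\<close> is the type after \<open>2 * t\<close> steps, within
      \<open>t\<close> of \<open>x\<close> and within 1 of \<open>y\<close>; \<open>w\<close> is the
      type between \<open>z\<close> and \<open>y\<close>, with \<open>z + w\<close> and
      \<open>w + y\<close> in \<open>{r - 1, r}\<close>.\<close>
    obtain z w where zw: "z \<le> r" "x \<le> z + t" "z \<le> x + t" "z + w \<le> r" "r \<le> Suc (z + w)"
      "w + y \<le> r" "r \<le> Suc (w + y)"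
    proof -
      consider "x \<le> y + t" "y \<le> x + t" | "x = Suc (y + t)" | "y = Suc (x + t)"
        using Suc.prems by linarith
      then show ?thesis
      proof cases
        case 1
        then show ?thesis using Suc.prems by (intro that[of y "r - y"]) auto
      next
        case 2
        then show ?thesis using Suc.prems by (intro that[of "Suc y" "r - Suc y"]) auto
      next
        case 3
        then show ?thesis using Suc.prems by (intro that[of "y - 1" "r - y"]) auto
      qed
    qed
    then have "0 < (type_mat n r ^\<^sub>m Suc (2 * t)) $$ (x, w)"
      using Suc n by (intro pow_step_pos[of _ _ z] type_mat_pos) auto
    then have "0 < (type_mat n r ^\<^sub>m Suc (Suc (2 * t))) $$ (x, y)"
      by (rule pow_step_pos[of x y w, rotated 3]) (use Suc.prems n zw in \<open>auto intro: type_mat_pos\<close>)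
    then show ?case by simp
  qed auto
  show ?thesis
  proof
    fix x y assume "x < Suc r" "y < Suc r"
    then show "0 < (type_mat n r ^\<^sub>m Suc (2 * r)) $$ (x, y)"
      by (intro pow_Suc_pos even_pos) auto
  qed simp
qed

section \<open>The invariant distribution\<close>

text \<open>The hypergeometric law, which is the law of the type of a uniformly random
  permutation.\<close>

definition type_dist :: "nat \<Rightarrow> nat \<Rightarrow> real vec" where
  "type_dist n r = vec (Suc r) (\<lambda>x. real ((r choose x) * ((n - r) choose (r - x))) / real (n choose r))"

lemma type_dist_index:
  "x \<le> r \<Longrightarrow> vec_index (type_dist n r) x = real ((r choose x) * ((n - r) choose (r - x))) / real (n choose r)"
  by (simp add: type_dist_def)

lemma type_mat_detailed_balance:
  assumes "2 * r < n"
  shows "detailed_balance (type_mat n r) (type_dist n r)"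
  unfolding detailed_balance_def
proof (intro allI impI)
  fix x y assume "x < dim_row (type_mat n r)" "y < dim_row (type_mat n r)"
  then have xy: "x \<le> r" "y \<le> r" by (auto simp: type_mat_def)
  \<comment> \<open>Both products of binomials now have the shape treated in
    \<open>choose_mult_choose_diff\<close>: one for a set of size \<open>r\<close> with parts
    \<open>x\<close> and \<open>y\<close>, one for a set of size \<open>n - r\<close> with parts
    \<open>r - x\<close> and \<open>r - y\<close>.\<close>
  have sub: "n - 2 * r + x = n - r - (r - x)" "n - 2 * r + y = n - r - (r - y)"
    using xy assms by auto
  have "((r choose x) * ((r - x) choose y)) * (((n - r) choose (r - x)) * ((n - 2 * r + x) choose (r - y)))
      = ((r choose y) * ((r - y) choose x)) * (((n - r) choose (r - y)) * ((n - 2 * r + y) choose (r - x)))"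
    unfolding sub
    using choose_mult_choose_diff[of r x y] choose_mult_choose_diff[of "n - r" "r - x" "r - y"]
    by simp
  then have "real ((r choose x) * ((n - r) choose (r - x))) * real (((r - x) choose y) * ((n - 2 * r + x) choose (r - y)))
      = real ((r choose y) * ((n - r) choose (r - y))) * real (((r - y) choose x) * ((n - 2 * r + y) choose (r - x)))"
    by (simp only: mult_ac flip: of_nat_mult)
  then show "vec_index (type_dist n r) x * type_mat n r $$ (x, y) = vec_index (type_dist n r) y * type_mat n r $$ (y, x)"
    using xy by (simp only: type_dist_index type_mat_entry times_divide_times_eq)
qed

lemma type_dist_invariant:
  assumes "2 * r < n"
  shows "invariant_distribution (type_mat n r) (type_dist n r)"
proof -
  interpret stochastic_chain "type_mat n r" "Suc r"
    by (rule type_mat_stochastic[OF assms])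
  have "(\<Sum>x\<le>r. (r choose x) * ((n - r) choose (r - x))) = n choose r"
    using vandermonde[of r "n - r" r] assms by simp
  then have "(\<Sum>x\<le>r. real ((r choose x) * ((n - r) choose (r - x)))) = real (n choose r)"
    by (metis of_nat_sum)
  moreover have "(\<Sum>x<Suc r. vec_index (type_dist n r) x)
      = (\<Sum>x\<le>r. real ((r choose x) * ((n - r) choose (r - x)))) / real (n choose r)"
    by (simp add: lessThan_Suc_atMost type_dist_index sum_divide_distrib)
  ultimately have "(\<Sum>x<Suc r. vec_index (type_dist n r) x) = 1"
    using assms by simp
  then show ?thesis
    using invariant_of_detailed_balance[OF type_mat_detailed_balance[OF assms]]
    by (auto simp: invariant_distribution_def type_dist_index less_Suc_eq_le) (auto simp: type_dist_def)
qed

section \<open>Eigenvalues of the transition matrix\<close>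

text \<open>Here \<open>k\<close> is the degree of the basis function; it corresponds to
  \<open>r - x\<close> in the formula of the theorem.\<close>

definition type_eigenvalue :: "nat \<Rightarrow> nat \<Rightarrow> nat \<Rightarrow> real" where
  "type_eigenvalue n r k = (-1) ^ k * real (r choose k) / real ((n - r) choose k)"

text \<open>The left side is what the binomial moments and the anti-diagonal entries produce;
  \<open>choose_mult\<close> converts it to the closed form.\<close>

lemma eigenvalue_ratio:
  assumes "k \<le> r" "2 * r < n"
  shows "real ((n - r - k) choose (r - k)) / real ((n - r) choose r) = real (r choose k) / real ((n - r) choose k)"
proof -
  have "((n - r) choose r) * (r choose k) = ((n - r) choose k) * ((n - r - k) choose (r - k))"
    using assms by (intro choose_mult) auto
  then have "real ((n - r) choose r) * real (r choose k) = real ((n - r) choose k) * real ((n - r - k) choose (r - k))"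
    by (metis of_nat_mult)
  then show ?thesis
    using assms by (simp add: field_simps)
qed

text \<open>
  In the basis of the functions \<open>x \<mapsto> x choose k\<close> the transition operator is upper triangular.
\<close>
lemma type_mat_eigenvalues:
  assumes n: "2 * r < n"
  shows "eigenvalue_mset (type_mat n r) = image_mset (type_eigenvalue n r) (mset_set {0..r})"
proof -
  \<comment> \<open>The columns of \<open>B\<close> are the basis functions, and \<open>T\<close> is
    the transition operator in this basis: the \<open>k\<close>th moment followed by
    \<open>binomial_diff_expand\<close> gives column \<open>k\<close>.\<close>
  define B :: "real mat" where "B = mat (Suc r) (Suc r) (\<lambda>(x, k). real (x choose k))"
  define T :: "real mat" where "T = mat (Suc r) (Suc r) (\<lambda>(j, k).
    if j \<le> k then (-1) ^ j * real ((r - j) choose (k - j)) * (real (r choose k) / real ((n - r) choose k)) else 0)"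
  have carr: "B \<in> carrier_mat (Suc r) (Suc r)" "T \<in> carrier_mat (Suc r) (Suc r)"
    by (auto simp: B_def T_def)
  have eq: "type_mat n r * B = B * T"
  proof (rule eq_matI)
    fix x k assume "x < dim_row (B * T)" "k < dim_col (B * T)"
    then have xk: "x \<le> r" "k \<le> r" by (auto simp: B_def T_def)
    have "(type_mat n r * B) $$ (x, k) = (\<Sum>y<Suc r. type_mat n r $$ (x, y) * real (y choose k))"
      using xk by (simp add: scalar_prod_def B_def type_mat_def lessThan_atLeast0 del: sum.op_ivl_Suc)
    also have "\<dots> = (\<Sum>y\<le>r. real (((r - x) choose y) * ((n - 2 * r + x) choose (r - y)) * (y choose k))
        / real ((n - r) choose r))"
      using xk by (simp add: lessThan_Suc_atMost type_mat_entry)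
    also have "\<dots> = real (\<Sum>y\<le>r. ((r - x) choose y) * ((n - 2 * r + x) choose (r - y)) * (y choose k))
        / real ((n - r) choose r)"
      by (simp only: of_nat_sum sum_divide_distrib)
    also have "\<dots> = real ((r - x) choose k) * (real ((n - r - k) choose (r - k)) / real ((n - r) choose r))"
      using xk n by (simp add: vandermonde_binomial_moment)
    also have "\<dots> = real ((r - x) choose k) * (real (r choose k) / real ((n - r) choose k))"
      using xk n by (simp only: eigenvalue_ratio)
    also have "\<dots> = (\<Sum>j\<le>k. real (x choose j) * T $$ (j, k))"
      unfolding binomial_diff_expand[OF xk(1)] sum_distrib_right
      using xk by (intro sum.cong) (auto simp: T_def)
    also have "\<dots> = (\<Sum>j<Suc r. real (x choose j) * T $$ (j, k))"
      using xk by (intro sum.mono_neutral_left) (auto simp: T_def)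
    also have "\<dots> = (B * T) $$ (x, k)"
      using xk by (simp add: scalar_prod_def B_def T_def lessThan_atLeast0 del: sum.op_ivl_Suc)
    finally show "(type_mat n r * B) $$ (x, k) = (B * T) $$ (x, k)" .
  qed (auto simp: B_def T_def type_mat_def)
  \<comment> \<open>As \<open>x choose k\<close> vanishes for \<open>x < k\<close>, \<open>B\<close>
    is lower triangular with unit diagonal, hence invertible, and \<open>type_mat n r\<close> is
    similar to \<open>T\<close>.\<close>
  have "det B = prod_list (diag_mat B)"
    by (rule det_lower_triangular[OF _ carr(1)]) (auto simp: B_def)
  also have "diag_mat B = map (\<lambda>_. 1) [0..<Suc r]"
    unfolding diag_mat_def by (rule map_cong) (auto simp: B_def)
  finally have "det B \<noteq> 0"
    by (simp add: map_replicate_const del: upt_Suc)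
  then obtain C where C: "C \<in> carrier_mat (Suc r) (Suc r)" "B * C = 1\<^sub>m (Suc r)" "C * B = 1\<^sub>m (Suc r)"
    using det_non_zero_imp_unit[OF carr(1), of "()"] by (auto simp: Units_def ring_mat_def)
  have "type_mat n r = type_mat n r * (B * C)"
    using C by (simp add: right_mult_one_mat[OF type_mat_carrier])
  also have "\<dots> = type_mat n r * B * C"
    by (rule assoc_mult_mat[OF type_mat_carrier carr(1) C(1), symmetric])
  finally have "type_mat n r = B * T * C"
    by (simp only: eq)
  then have "similar_mat (type_mat n r) T"
    using C carr by (intro similar_matI[of _ _ B C "Suc r"]) auto
  then have "char_poly (type_mat n r) = char_poly T"
    by (rule char_poly_similar)
  also have "\<dots> = (\<Prod>a\<leftarrow>diag_mat T. [:- a, 1:])"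
    using carr by (intro char_poly_upper_triangular[of _ "Suc r"]) (auto simp: T_def upper_triangular_def)
  also have "diag_mat T = map (type_eigenvalue n r) [0..<Suc r]"
    unfolding diag_mat_def by (rule map_cong) (auto simp: T_def type_eigenvalue_def)
  finally have cp: "char_poly (type_mat n r) = (\<Prod>k\<leftarrow>[0..<Suc r]. [:- type_eigenvalue n r k, 1:])"
    by (simp add: o_def del: upt_Suc)
  have "proots (\<Prod>k\<leftarrow>ks. [:- type_eigenvalue n r k, 1:]) = mset (map (type_eigenvalue n r) ks)" for ks
  proof (induction ks)
    case (Cons k ks)
    have "(\<Prod>k\<leftarrow>ks. [:- type_eigenvalue n r k, 1:]) \<noteq> 0"
      by (auto simp: prod_list_zero_iff)
    then have "proots ([:- type_eigenvalue n r k, 1:] * (\<Prod>k\<leftarrow>ks. [:- type_eigenvalue n r k, 1:]))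
        = {#type_eigenvalue n r k#} + mset (map (type_eigenvalue n r) ks)"
      by (subst proots_mult) (simp_all add: Cons.IH del: mult_pCons_left)
    then show ?case by (simp del: mult_pCons_left)
  qed simp
  then show ?thesis
    unfolding eigenvalue_mset_def cp mset_map
    by (metis atLeastLessThanSuc_atLeastAtMost mset_upt)
qed

text \<open>In the entry \<open>(r - j, j)\<close> the first binomial is
  \<open>j choose j = 1\<close>, and the quotient that remains is the absolute value of an
  eigenvalue by \<open>eigenvalue_ratio\<close>.\<close>

lemma type_mat_anti_diagonal:
  assumes n: "2 * r < n"
  shows "anti_diagonal_eigenvalue_property r (type_mat n r)"
  unfolding anti_diagonal_eigenvalue_property_def
proof (intro conjI allI impI)
  fix i j assume "i \<le> r" "j \<le> r" "r < i + j"
  moreover from this have "r - i < j"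
    by linarith
  ultimately show "type_mat n r $$ (i, j) = 0"
    by (simp add: type_mat_entry binomial_eq_0)
next
  have "type_eigenvalue n r j = (-1) ^ j * type_mat n r $$ (r - j, j)" if "j \<le> r" for j
  proof -
    have "n - 2 * r + (r - j) = n - r - j"
      using that n by simp
    then have "type_mat n r $$ (r - j, j) = real ((n - r - j) choose (r - j)) / real ((n - r) choose r)"
      using that by (simp add: type_mat_entry)
    then show ?thesis
      using eigenvalue_ratio[OF that n] by (simp add: type_eigenvalue_def)
  qed
  then show "eigenvalue_mset (type_mat n r)
      = image_mset (\<lambda>j. (-1) ^ j * type_mat n r $$ (r - j, j)) (mset_set {0..r})"
    unfolding type_mat_eigenvalues[OF n] by (intro image_mset_cong) auto
qed simp

text \<open>The ratio of the two absolute values is \<open>(r - k) / (n - r - k)\<close>, which is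
  less than 1 since \<open>r < n - r\<close>. The inequality is proved with denominators
  cleared.\<close>

lemma abs_type_eigenvalue_Suc_less:
  assumes "k < r" "2 * r < n"
  shows "\<bar>type_eigenvalue n r (Suc k)\<bar> < \<bar>type_eigenvalue n r k\<bar>"
proof -
  have pos: "0 < r choose k" "0 < (n - r) choose Suc k" "0 < (n - r) choose k"
    using assms by auto
  have step: "Suc k * (m choose Suc k) = (m - k) * (m choose k)" for m
    by (simp only: binomial_absorb_comp binomial_absorption)
  have "Suc k * ((r choose Suc k) * ((n - r) choose k)) = (r - k) * ((r choose k) * ((n - r) choose k))"
    using step[of r] by (metis mult.assoc)
  also have "\<dots> < (n - r - k) * ((r choose k) * ((n - r) choose k))"
    using pos assms by (intro mult_strict_right_mono) auto
  also have "\<dots> = Suc k * ((r choose k) * ((n - r) choose Suc k))"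
    using step[of "n - r"] by (metis mult.assoc mult.left_commute)
  finally have "(r choose Suc k) * ((n - r) choose k) < (r choose k) * ((n - r) choose Suc k)"
    using mult_less_cancel1 by blast
  then have "real (r choose Suc k) * real ((n - r) choose k) < real (r choose k) * real ((n - r) choose Suc k)"
    by (metis of_nat_less_iff of_nat_mult)
  then show ?thesis
    using pos by (simp add: type_eigenvalue_def abs_mult power_abs divide_less_eq less_divide_eq mult_ac del: binomial_Suc_Suc)
qed

lemma abs_type_eigenvalue_less:
  assumes "i < j" "j \<le> r" "2 * r < n"
  shows "\<bar>type_eigenvalue n r j\<bar> < \<bar>type_eigenvalue n r i\<bar>"
  using assms
proof (induction j)
  case (Suc j)
  then show ?case
    using abs_type_eigenvalue_Suc_less[of j r n] by (cases "i = j") auto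
qed simp

lemma type_mat_second_largest_eigenvalue:
  assumes n: "2 * r < n" and r: "1 \<le> r"
  shows "second_largest_abs_eigenvalue (type_mat n r) (- (real r / real (n - r)))"
proof -
  have "{0..r} = insert 0 (insert 1 {2..r})"
    using r by auto
  then have "eigenvalue_mset (type_mat n r) = add_mset (type_eigenvalue n r 0)
      (add_mset (type_eigenvalue n r 1) (image_mset (type_eigenvalue n r) (mset_set {2..r})))"
    by (simp add: type_mat_eigenvalues[OF n])
  moreover have "type_eigenvalue n r 1 = - (real r / real (n - r))"
    by (simp add: type_eigenvalue_def)
  moreover have "\<bar>type_eigenvalue n r 1\<bar> < \<bar>type_eigenvalue n r 0\<bar>"
    using n r by (intro abs_type_eigenvalue_less) auto
  moreover have "\<bar>c\<bar> < \<bar>type_eigenvalue n r 1\<bar>" if "c \<in># image_mset (type_eigenvalue n r) (mset_set {2..r})" for c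
    using that n by (auto intro!: abs_type_eigenvalue_less)
  ultimately show ?thesis
    unfolding second_largest_abs_eigenvalue_def by metis
qed

section \<open>Double cosets and moves\<close>

lemma ex_permutes_image_eq:
  assumes "finite S" "A \<subseteq> S" "B \<subseteq> S" "card A = card B"
  obtains p where "p permutes S" "p ` A = B"
proof -
  have fin: "finite A" "finite B"
    using assms finite_subset by auto
  obtain f where f: "bij_betw f A B"
    using finite_same_card_bij[OF fin assms(4)] by blast
  obtain g where g: "bij_betw g (S - A) (S - B)"
    using finite_same_card_bij[of "S - A" "S - B"] assms fin by (auto simp: card_Diff_subset)
  define h where "h x = (if x \<in> A then f x else g x)" for x
  have "bij_betw h (A \<union> (S - A)) (B \<union> (S - B))"
  proof (rule bij_betw_combine)
    show "bij_betw h A B"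
      using f by (subst bij_betw_cong[of A h f]) (auto simp: h_def)
    show "bij_betw h (S - A) (S - B)"
      using g by (subst bij_betw_cong[of "S - A" h g]) (auto simp: h_def)
  qed auto
  moreover have "A \<union> (S - A) = S" "B \<union> (S - B) = S"
    using assms by auto
  ultimately have "restrict_id h S permutes S"
    by (simp add: permutes_restrict_id)
  moreover have "restrict_id h S ` A = B"
    using f assms(2) by (auto simp: restrict_id_def h_def bij_betw_def image_iff)
  ultimately show ?thesis by (rule that)
qed

lemma permutes_image_Diff:
  assumes "p permutes S" "A \<subseteq> S"
  shows "p ` (S - A) = S - p ` A"
  using assms by (metis image_set_diff permutes_image permutes_inj)

lemma split_interval:
  fixes r n :: nat
  assumes "r \<le> n"
  shows "{1..n} - {1..r} = {r + 1..n}" "{1..r} \<subseteq> {1..n}"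
  using assms by auto

lemma young_subgroup_eq:
  assumes "r \<le> n"
  shows "young_subgroup n r = {h \<in> sym_grp n. h ` {1..r} = {1..r}}"
proof -
  have "h ` {r + 1..n} = {r + 1..n}" if "h permutes {1..n}" "h ` {1..r} = {1..r}" for h
    using permutes_image_Diff[OF that(1), of "{1..r}"] that(2) split_interval[OF assms] by simp
  then show ?thesis
    unfolding young_subgroup_def sym_grp_def by blast
qed

lemma perm_type_mult_young:
  assumes "r \<le> n" "g \<in> sym_grp n" "h \<in> young_subgroup n r" "k \<in> young_subgroup n r"
  shows "perm_type r (perm_mult (perm_mult h g) k) = perm_type r g"
proof -
  have hk: "h ` {1..r} = {1..r}" "k ` {1..r} = {1..r}" "inj k"
    using assms by (auto simp: young_subgroup_eq sym_grp_def permutes_inj)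
  have "perm_mult (perm_mult h g) k ` {1..r} \<inter> {1..r} = k ` (g ` {1..r}) \<inter> k ` {1..r}"
    by (simp only: perm_mult_def hk image_comp[symmetric])
  also have "\<dots> = k ` (g ` {1..r} \<inter> {1..r})"
    by (rule image_Int[OF hk(3), symmetric])
  finally show ?thesis
    using hk(3) by (simp add: perm_type_def card_image inj_on_subset)
qed

text \<open>The parts of \<open>A\<close> and \<open>B\<close> inside \<open>{1..r}\<close> have
  equal size, and so do the parts outside; a permutation of each block matches them, and neither
  disturbs the other block.\<close>

lemma ex_young_image_eq:
  assumes "r \<le> n" and A: "A \<subseteq> {1..n}" "card A = c" "card (A \<inter> {1..r}) = x"
    and B: "B \<subseteq> {1..n}" "card B = c" "card (B \<inter> {1..r}) = x"
  obtains k where "k \<in> young_subgroup n r" "k ` A = B"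
proof -
  have fin: "finite A" "finite B"
    using A B finite_subset by auto
  obtain p where p: "p permutes {1..r}" "p ` (A \<inter> {1..r}) = B \<inter> {1..r}"
    by (rule ex_permutes_image_eq[of "{1..r}" "A \<inter> {1..r}" "B \<inter> {1..r}"]) (use A B in auto)
  have "card (A - {1..r}) = card (B - {1..r})"
    using A B fin by (simp add: card_Diff_subset_Int)
  then obtain q where q: "q permutes {r + 1..n}" "q ` (A - {1..r}) = B - {1..r}"
    by (rule ex_permutes_image_eq[of "{r + 1..n}" "A - {1..r}" "B - {1..r}", rotated 3]) (use A B in auto)
  have p_id: "p ` C = C" if "C \<inter> {1..r} = {}" for C
    using permutes_not_in[OF p(1)] that by (force simp: image_iff)
  have q_id: "q ` C = C" if "C \<inter> {r + 1..n} = {}" for C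
    using permutes_not_in[OF q(1)] that by (force simp: image_iff)
  have "p permutes {1..n}" "q permutes {1..n}"
    using permutes_subset[OF p(1), of "{1..n}"] permutes_subset[OF q(1), of "{1..n}"] assms by auto
  then have "p \<circ> q \<in> sym_grp n"
    by (simp add: sym_grp_def permutes_compose)
  moreover have "(p \<circ> q) ` {1..r} = {1..r}"
    using q_id[of "{1..r}"] permutes_image[OF p(1)] by (simp flip: image_image)
  moreover have "(p \<circ> q) ` A = B"
  proof -
    have "(p \<circ> q) ` A = p ` q ` (A \<inter> {1..r}) \<union> p ` q ` (A - {1..r})"
      by auto
    also have "q ` (A \<inter> {1..r}) = A \<inter> {1..r}"
      by (rule q_id) auto
    also have "p ` q ` (A - {1..r}) = B - {1..r}"
      unfolding q(2) by (rule p_id) auto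
    finally show ?thesis
      unfolding p(2) by auto
  qed
  ultimately show ?thesis
    using assms(1) by (intro that[of "p \<circ> q"]) (auto simp: young_subgroup_eq)
qed

lemma double_coset_eq_same_type:
  assumes r: "r \<le> n" and g: "g \<in> sym_grp n"
  shows "double_coset n r g = {g' \<in> sym_grp n. perm_type r g' = perm_type r g}"
proof (intro Set.equalityI subsetI)
  fix g' assume "g' \<in> double_coset n r g"
  then obtain h k where hk: "h \<in> young_subgroup n r" "k \<in> young_subgroup n r" "g' = perm_mult (perm_mult h g) k"
    by (auto simp: double_coset_def)
  then have "g' \<in> sym_grp n"
    using g by (auto simp: young_subgroup_def sym_grp_def perm_mult_def intro!: permutes_compose)
  with hk show "g' \<in> {g' \<in> sym_grp n. perm_type r g' = perm_type r g}"
    using perm_type_mult_young[OF r g] by simp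
next
  fix g' assume "g' \<in> {g' \<in> sym_grp n. perm_type r g' = perm_type r g}"
  then have g': "g' permutes {1..n}" "perm_type r g' = perm_type r g"
    by (auto simp: sym_grp_def)
  have g: "g permutes {1..n}"
    using g by (simp add: sym_grp_def)
  have sub: "p ` {1..r} \<subseteq> {1..n}" "card (p ` {1..r}) = r" if "p permutes {1..n}" for p
    using that r permutes_image[OF that]
    by (force, simp add: card_image inj_on_subset[OF permutes_inj])
  obtain k where k: "k \<in> young_subgroup n r" "k ` g ` {1..r} = g' ` {1..r}"
    using sub[OF g] sub[OF g'(1)] g'(2)
    by (elim ex_young_image_eq[OF r, of "g ` {1..r}" r "perm_type r g" "g' ` {1..r}", rotated -1])
      (auto simp: perm_type_def)
  have k_perm: "k permutes {1..n}"
    using k by (simp add: young_subgroup_def sym_grp_def)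
  \<comment> \<open>This solves \<open>g' = hgk\<close> for \<open>h\<close>. By the choice of
    \<open>k\<close>, \<open>g'\<close> and \<open>k \<circ> g\<close> send \<open>{1..r}\<close> to
    the same set, so \<open>h\<close> preserves \<open>{1..r}\<close>.\<close>
  define h where "h = inv_into UNIV (k \<circ> g) \<circ> g'"
  have kg: "(k \<circ> g) permutes {1..n}"
    using k_perm g by (simp add: permutes_compose)
  have "h permutes {1..n}"
    unfolding h_def by (rule permutes_compose[OF g'(1) permutes_inv[OF kg]])
  moreover have "h ` {1..r} = {1..r}"
  proof -
    have "h ` {1..r} = inv_into UNIV (k \<circ> g) ` (k \<circ> g) ` {1..r}"
      unfolding h_def image_comp[symmetric] k(2) ..
    then show ?thesis
      by (simp only: image_inv_f_f[OF permutes_inj[OF kg]])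
  qed
  ultimately have "h \<in> young_subgroup n r"
    using r by (simp add: young_subgroup_eq sym_grp_def)
  moreover have "g' = perm_mult (perm_mult h g) k"
    using permutes_inverses(1)[OF kg] by (simp add: perm_mult_def h_def fun_eq_iff)
  ultimately show "g' \<in> double_coset n r g"
    using k by (auto simp: double_coset_def)
qed

lemma coset_type_double_coset:
  assumes "r \<le> n" "g \<in> sym_grp n"
  shows "coset_type r (double_coset n r g) = perm_type r g"
  unfolding coset_type_def double_coset_eq_same_type[OF assms]
  using assms by (intro the_equality) auto

lemma double_coset_eq_iff:
  assumes "r \<le> n" "g \<in> sym_grp n" "g' \<in> sym_grp n"
  shows "double_coset n r g = double_coset n r g' \<longleftrightarrow> perm_type r g = perm_type r g'"
  using assms by (auto simp: double_coset_eq_same_type)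

lemma perm_type_le: "perm_type r g \<le> r"
  unfolding perm_type_def using card_mono[of "{1..r}" "g ` {1..r} \<inter> {1..r}"] by simp

lemma ex_perm_type:
  assumes "2 * r \<le> n" "x \<le> r"
  obtains g where "g \<in> sym_grp n" "perm_type r g = x"
proof -
  \<comment> \<open>\<open>x\<close> points of \<open>{1..r}\<close> together with the first
    \<open>r - x\<close> points beyond it; they fit since \<open>2 * r \<le> n\<close>.\<close>
  let ?A = "{1..x} \<union> {r + 1..2 * r - x}"
  have "card {1..r} = card ?A"
    using assms by (subst card_Un_disjoint) auto
  then obtain g where g: "g permutes {1..n}" "g ` {1..r} = ?A"
    by (rule ex_permutes_image_eq[of "{1..n}" "{1..r}" ?A, rotated 3]) (use assms in auto)
  moreover have "?A \<inter> {1..r} = {1..x}"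
    using assms by auto
  ultimately show ?thesis
    by (intro that[of g]) (auto simp: sym_grp_def perm_type_def)
qed

lemma bij_betw_coset_type:
  assumes "2 * r \<le> n"
  shows "bij_betw (coset_type r) (double_cosets n r) {0..r}"
proof -
  have r: "r \<le> n" using assms by simp
  have "inj_on (coset_type r) (double_cosets n r)"
    using r by (auto simp: inj_on_def double_cosets_def coset_type_double_coset double_coset_eq_iff)
  moreover have "coset_type r ` double_cosets n r = perm_type r ` sym_grp n"
    unfolding double_cosets_def image_image using r by (intro image_cong) (auto simp: coset_type_double_coset)
  moreover have "perm_type r ` sym_grp n = {0..r}"
  proof (intro Set.equalityI subsetI)
    fix x assume "x \<in> {0..r}"
    then obtain g where "g \<in> sym_grp n" "perm_type r g = x"
      using ex_perm_type[OF assms] by auto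
    then show "x \<in> perm_type r ` sym_grp n" by blast
  qed (use perm_type_le in auto)
  ultimately show ?thesis
    by (simp add: bij_betw_def)
qed

section \<open>Moves correspond to the \<open>r\<close>-subsets of \<open>{r+1..n}\<close>\<close>

text \<open>Applied to the sorted list of \<open>A\<close>, each map yields the sorted list of the
  common image.\<close>

lemma strict_mono_on_image_unique:
  fixes f g :: "'a::linorder \<Rightarrow> 'b::linorder"
  assumes "finite A" "strict_mono_on A f" "strict_mono_on A g" "f ` A = g ` A" "x \<in> A"
  shows "f x = g x"
proof -
  let ?xs = "sorted_list_of_set A"
  have "sorted (map h ?xs)" "distinct (map h ?xs)" if "strict_mono_on A h" for h :: "'a \<Rightarrow> 'b"
  proof -
    have "sorted_wrt (\<lambda>x y. h x < h y) ?xs"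
      by (rule sorted_wrt_mono_rel[OF _ strict_sorted_list_of_set])
        (use that assms(1) in \<open>auto simp: strict_mono_on_def\<close>)
    then have "sorted_wrt (<) (map h ?xs)"
      by (simp add: sorted_wrt_map)
    then show "sorted (map h ?xs)" "distinct (map h ?xs)"
      by (auto simp: strict_sorted_iff)
  qed
  then have "map f ?xs = map g ?xs"
    using assms by (intro sorted_distinct_set_unique) auto
  then show ?thesis
    using assms by (auto simp: map_eq_conv)
qed

lemma ex_strict_mono_on_image:
  fixes A :: "'a::wellorder set" and B :: "'b::wellorder set"
  assumes "finite A" "finite B" "card A = card B"
  obtains f where "strict_mono_on A f" "f ` A = B"
proof -
  obtain a where a: "bij_betw a {..<card A} A" "strict_mono_on {..<card A} a"
    using ex_bij_betw_strict_mono_card[OF assms(1)] .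
  obtain b where b: "bij_betw b {..<card A} B" "strict_mono_on {..<card A} b"
    using ex_bij_betw_strict_mono_card[OF assms(2)] assms(3) by metis
  have "strict_mono_on A (b \<circ> inv_into {..<card A} a)"
  proof (rule strict_mono_onI)
    fix x y assume xy: "x \<in> A" "y \<in> A" "x < y"
    then obtain i j where ij: "i < card A" "j < card A" "x = a i" "y = a j"
      using a(1) unfolding bij_betw_def by (metis imageE lessThan_iff)
    then have "i < j"
      using xy(3) a(2) by (metis lessThan_iff linorder_neqE_nat order_less_asym strict_mono_onD)
    then show "(b \<circ> inv_into {..<card A} a) x < (b \<circ> inv_into {..<card A} a) y"
      using ij a(1) b(2) by (simp add: bij_betw_def strict_mono_onD)
  qed
  moreover have "(b \<circ> inv_into {..<card A} a) ` A = B"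
    using bij_betw_trans[OF bij_betw_inv_into[OF a(1)] b(1)] by (simp add: bij_betw_def)
  ultimately show ?thesis by (rule that)
qed

lemma skewed_moves_subset: "skewed_moves n r \<subseteq> sym_grp n"
  by (auto simp: skewed_moves_def)

lemma finite_sym_grp: "finite (sym_grp n)"
  by (simp add: sym_grp_def finite_permutations)

lemma finite_skewed_moves: "finite (skewed_moves n r)"
  using finite_subset[OF skewed_moves_subset finite_sym_grp] .

text \<open>Recovers \<open>R\<close> from \<open>d\<^sub>R\<close> as the preimage of
  \<open>{1..r}\<close>, replacing the existentially quantified set in \<open>skewed_moves\<close>
  by a function of \<open>d\<close>.\<close>

definition lifted_set :: "nat \<Rightarrow> nat \<Rightarrow> (nat \<Rightarrow> nat) \<Rightarrow> nat set" where
  "lifted_set n r d = {i \<in> {1..n}. d i \<in> {1..r}}"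

lemma lifted_set_eq:
  assumes "d permutes {1..n}" "R \<subseteq> {1..n}" "d ` R = {1..r}"
  shows "lifted_set n r d = R"
proof (intro Set.equalityI subsetI)
  fix i assume "i \<in> lifted_set n r d"
  then have "d i \<in> d ` R"
    by (simp add: lifted_set_def assms(3))
  then show "i \<in> R"
    using permutes_inj[OF assms(1)] by (simp add: inj_image_mem_iff)
next
  fix i assume "i \<in> R"
  moreover from this have "d i \<in> {1..r}"
    using assms(3) by blast
  ultimately show "i \<in> lifted_set n r d"
    using assms(2) by (auto simp: lifted_set_def)
qed

lemma skewed_movesD:
  assumes "d \<in> skewed_moves n r"
  shows "d permutes {1..n}" "lifted_set n r d \<subseteq> {r + 1..n}" "card (lifted_set n r d) = r"
    "d ` lifted_set n r d = {1..r}" "strict_mono_on (lifted_set n r d) d"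
    "strict_mono_on ({1..n} - lifted_set n r d) d"
proof -
  obtain R where R: "d permutes {1..n}" "R \<subseteq> {r + 1..n}" "card R = r"
      "d ` R = {1..r}" "strict_mono_on R d" "strict_mono_on ({1..n} - R) d"
    using assms by (auto simp: skewed_moves_def sym_grp_def)
  then have "lifted_set n r d = R"
    by (intro lifted_set_eq) auto
  with R show "d permutes {1..n}" "lifted_set n r d \<subseteq> {r + 1..n}" "card (lifted_set n r d) = r"
    "d ` lifted_set n r d = {1..r}" "strict_mono_on (lifted_set n r d) d"
    "strict_mono_on ({1..n} - lifted_set n r d) d"
    by simp_all
qed

text \<open>\<open>R\<close> fixes the images of \<open>R\<close> and of its complement, and an
  increasing map is determined by its image; conversely, two increasing maps onto these images glue
  to a move.\<close>

lemma bij_betw_lifted_set: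
  assumes "r \<le> n"
  shows "bij_betw (lifted_set n r) (skewed_moves n r) {R. R \<subseteq> {r + 1..n} \<and> card R = r}"
  unfolding bij_betw_def
proof (intro conjI Set.equalityI subsetI inj_onI)
  fix d e assume d: "d \<in> skewed_moves n r" and e: "e \<in> skewed_moves n r"
    and eq: "lifted_set n r d = lifted_set n r e"
  let ?R = "lifted_set n r e"
  note d = skewed_movesD(1,4-6)[OF d, unfolded eq]
  note e = skewed_movesD(1,2,4-6)[OF e]
  have sub: "?R \<subseteq> {1..n}"
    using e(2) by auto
  have fin: "finite ?R"
    using sub finite_subset by blast
  show "d = e"
  proof
    fix i
    consider "i \<in> ?R" | "i \<in> {1..n} - ?R" | "i \<notin> {1..n}" by blast
    then show "d i = e i"
    proof cases
      case 1
      then show ?thesis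
        using d(2,3) e(3,4) fin by (intro strict_mono_on_image_unique[of ?R]) auto
    next
      case 2
      have "d ` ({1..n} - ?R) = e ` ({1..n} - ?R)"
        using permutes_image_Diff[OF d(1) sub] permutes_image_Diff[OF e(1) sub] d(2) e(3) by simp
      with 2 show ?thesis
        using d(4) e(5) by (intro strict_mono_on_image_unique[of "{1..n} - ?R"]) auto
    next
      case 3
      then show ?thesis
        using d(1) e(1) by (simp add: permutes_not_in)
    qed
  qed
next
  fix R assume "R \<in> lifted_set n r ` skewed_moves n r"
  then show "R \<in> {R. R \<subseteq> {r + 1..n} \<and> card R = r}"
    using skewed_movesD(2,3) by blast
next
  fix R assume "R \<in> {R. R \<subseteq> {r + 1..n} \<and> card R = r}"
  then have R: "R \<subseteq> {r + 1..n}" "card R = r" by auto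
  have sub: "R \<subseteq> {1..n}" and fin: "finite R"
    using R finite_subset by auto
  have card: "card ({1..n} - R) = card {r + 1..n}"
    using R fin sub by (simp add: card_Diff_subset)
  obtain f where f: "strict_mono_on R f" "f ` R = {1..r}"
    using ex_strict_mono_on_image[of R "{1..r}"] fin R by auto
  obtain g where g: "strict_mono_on ({1..n} - R) g" "g ` ({1..n} - R) = {r + 1..n}"
    using ex_strict_mono_on_image[of "{1..n} - R" "{r + 1..n}"] card by auto
  \<comment> \<open>\<open>restrict_id\<close> supplies the identity outside \<open>{1..n}\<close>,
    as \<open>permutes\<close> requires.\<close>
  define d where "d = restrict_id (\<lambda>i. if i \<in> R then f i else g i) {1..n}"
  have d_R: "d i = f i" if "i \<in> R" for i
    using that sub by (auto simp: d_def restrict_id_def)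
  have d_notR: "d i = g i" if "i \<in> {1..n} - R" for i
    using that by (auto simp: d_def restrict_id_def)
  have mono: "strict_mono_on R d" "strict_mono_on ({1..n} - R) d"
    using f(1) g(1) by (auto simp: strict_mono_on_def d_R d_notR)
  have img: "d ` R = {1..r}" "d ` ({1..n} - R) = {r + 1..n}"
    using f(2) g(2) d_R d_notR by (metis image_cong)+
  have "bij_betw d (R \<union> ({1..n} - R)) ({1..r} \<union> {r + 1..n})"
    by (rule bij_betw_combine)
      (use mono img strict_mono_on_imp_inj_on in \<open>auto simp: bij_betw_def\<close>)
  moreover have "R \<union> ({1..n} - R) = {1..n}" "{1..r} \<union> {r + 1..n} = {1..n}"
    using sub assms by auto
  ultimately have "d permutes {1..n}"
    by (intro bij_imp_permutes) (auto simp: d_def restrict_id_def)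
  then have "d \<in> skewed_moves n r" "lifted_set n r d = R"
    using R mono img sub lifted_set_eq by (auto simp: skewed_moves_def sym_grp_def)
  then show "R \<in> lifted_set n r ` skewed_moves n r"
    by blast
qed

lemma card_skewed_moves:
  assumes "r \<le> n"
  shows "card (skewed_moves n r) = (n - r) choose r"
  using bij_betw_same_card[OF bij_betw_lifted_set[OF assms]] by (simp add: n_subsets)

section \<open>Transition probabilities by counting subsets\<close>

text \<open>The set \<open>R\<close> splits into \<open>A \<inter> R\<close> and
  \<open>R - A\<close>, which can be chosen independently.\<close>

lemma card_subsets_Int_eq:
  assumes "finite S" "A \<subseteq> S" "y \<le> r"
  shows "card {R. R \<subseteq> S \<and> card R = r \<and> card (A \<inter> R) = y} = (card A choose y) * (card (S - A) choose (r - y))"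
proof -
  have fin: "finite A"
    using assms finite_subset by blast
  have "bij_betw (\<lambda>R. (A \<inter> R, R - A)) {R. R \<subseteq> S \<and> card R = r \<and> card (A \<inter> R) = y}
      ({X. X \<subseteq> A \<and> card X = y} \<times> {Y. Y \<subseteq> S - A \<and> card Y = r - y})"
  proof (rule bij_betw_byWitness[where f' = "\<lambda>(X, Y). X \<union> Y"])
    show "(\<lambda>R. (A \<inter> R, R - A)) ` {R. R \<subseteq> S \<and> card R = r \<and> card (A \<inter> R) = y}
        \<subseteq> {X. X \<subseteq> A \<and> card X = y} \<times> {Y. Y \<subseteq> S - A \<and> card Y = r - y}"
      using fin by (auto simp: card_Diff_subset_Int Int_commute)
    show "(\<lambda>(X, Y). X \<union> Y) ` ({X. X \<subseteq> A \<and> card X = y} \<times> {Y. Y \<subseteq> S - A \<and> card Y = r - y})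
        \<subseteq> {R. R \<subseteq> S \<and> card R = r \<and> card (A \<inter> R) = y}"
    proof clarsimp
      fix X Y assume XY: "X \<subseteq> A" "Y \<subseteq> S - A" "y = card X" "card Y = r - card X"
      moreover have "card (X \<union> Y) = card X + card Y"
        using XY assms fin finite_subset[of X A] finite_subset[of Y S] by (intro card_Un_disjoint) auto
      moreover have "A \<inter> (X \<union> Y) = X"
        using XY by auto
      ultimately show "X \<subseteq> S \<and> Y \<subseteq> S \<and> card (X \<union> Y) = r \<and> card (A \<inter> (X \<union> Y)) = card X"
        using assms by auto
    qed
  qed auto
  then show ?thesis
    using assms fin by (simp add: bij_betw_same_card card_cartesian_product n_subsets)
qed

text \<open>
  Writing \<open>A\<close> for the image of \<open>{1..r}\<close> under \<open>g\<close>, the type of \<open>gd\<^sub>R\<close> is the size of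
  \<open>A \<inter> R\<close>, and \<open>A\<close> contains exactly \<open>r - x\<close> of the points of \<open>{r+1..n}\<close>.
\<close>
lemma skewed_moves_transition:
  assumes n: "2 * r < n" and g: "g \<in> sym_grp n" and y: "y \<le> r"
  shows "real (card {d \<in> skewed_moves n r. perm_type r (perm_mult g d) = y}) / real (card (skewed_moves n r))
    = type_mat n r $$ (perm_type r g, y)"
proof -
  define A where "A = g ` {1..r} \<inter> {r + 1..n}"
  have g_perm: "g permutes {1..n}"
    using g by (simp add: sym_grp_def)
  have "g ` {1..r} \<subseteq> {1..n}"
    using permutes_image[OF g_perm] n by force
  then have "A = g ` {1..r} - (g ` {1..r} \<inter> {1..r})"
    by (auto simp: A_def)
  then have card_A: "card A = r - perm_type r g"
    using inj_on_subset[OF permutes_inj[OF g_perm], of "{1..r}"]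
    by (simp add: card_Diff_subset perm_type_def card_image)
  have type: "perm_type r (perm_mult g d) = card (A \<inter> lifted_set n r d)" if "d \<in> skewed_moves n r" for d
  proof -
    note d = skewed_movesD(1,2,4)[OF that]
    have "perm_mult g d ` {1..r} \<inter> {1..r} = d ` g ` {1..r} \<inter> d ` lifted_set n r d"
      by (simp add: perm_mult_def d(3) image_comp)
    also have "\<dots> = d ` (g ` {1..r} \<inter> lifted_set n r d)"
      by (rule image_Int[OF permutes_inj[OF d(1)], symmetric])
    \<comment> \<open>The skewness of the shuffle enters here: the lifted positions all lie beneath
      position \<open>r\<close>, so only the part \<open>A\<close> of the image matters.\<close>
    also have "g ` {1..r} \<inter> lifted_set n r d = A \<inter> lifted_set n r d"
      using d(2) by (auto simp: A_def)
    finally show ?thesis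
      using inj_on_subset[OF permutes_inj[OF d(1)]] by (simp add: perm_type_def card_image)
  qed
  have "bij_betw (lifted_set n r) {d \<in> skewed_moves n r. perm_type r (perm_mult g d) = y}
      {R. R \<subseteq> {r + 1..n} \<and> card R = r \<and> card (A \<inter> R) = y}"
  proof -
    have bij: "bij_betw (lifted_set n r) (skewed_moves n r) {R. R \<subseteq> {r + 1..n} \<and> card R = r}"
      using n by (intro bij_betw_lifted_set) simp
    have "lifted_set n r ` {d \<in> skewed_moves n r. perm_type r (perm_mult g d) = y}
        = {R \<in> lifted_set n r ` skewed_moves n r. card (A \<inter> R) = y}"
      using type by auto
    then show ?thesis
      using bij by (auto simp: bij_betw_def inj_on_def)
  qed
  then have "card {d \<in> skewed_moves n r. perm_type r (perm_mult g d) = y}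
      = (card A choose y) * (card ({r + 1..n} - A) choose (r - y))"
    using card_subsets_Int_eq[of "{r + 1..n}" A y r] y by (simp add: bij_betw_same_card A_def)
  moreover have "card ({r + 1..n} - A) = n - 2 * r + perm_type r g"
    using n perm_type_le[of r g] card_A by (subst card_Diff_subset) (auto simp: A_def)
  ultimately show ?thesis
    using y n perm_type_le by (simp add: card_A card_skewed_moves type_mat_entry)
qed

section \<open>The walk on double cosets\<close>

text \<open>\<open>shuffle_walk\<close> recurses on the last move, whereas integration over a stream
  splits off the first.\<close>

lemma shuffle_walk_Cons:
  "shuffle_walk (Suc t) (g, d ## \<omega>) = shuffle_walk t (perm_mult g d, \<omega>)"
  by (induction t) auto

lemma perm_mult_in_sym_grp: "g \<in> sym_grp n \<Longrightarrow> h \<in> sym_grp n \<Longrightarrow> perm_mult g h \<in> sym_grp n"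
  by (simp add: sym_grp_def perm_mult_def permutes_compose)

locale skewed_shuffle =
  fixes n r :: nat
  assumes less: "2 * r < n"
begin

abbreviation "move_measure \<equiv> uniform_count_measure (skewed_moves n r)"

abbreviation "moves_space \<equiv> stream_space move_measure"

abbreviation "Q \<equiv> type_mat n r"

lemma card_moves_pos: "0 < card (skewed_moves n r)"
  using less by (simp add: card_skewed_moves)

lemma prob_space_moves: "prob_space move_measure"
  using card_moves_pos by (intro prob_space_uniform_count_measure) (auto simp: card_gt_0_iff)

lemma prob_space_moves_space: "prob_space moves_space"
  by (rule prob_space.prob_space_stream_space[OF prob_space_moves])

lemma measurable_shuffle_walk:
  assumes \<mu>: "sets \<mu> = Pow (sym_grp n)"
  shows "shuffle_walk t \<in> measurable (\<mu> \<Otimes>\<^sub>M moves_space) (count_space (sym_grp n))"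
proof (induction t)
  case 0
  have "sets \<mu> = sets (count_space (sym_grp n))"
    by (simp add: \<mu>)
  then have "fst \<in> measurable (\<mu> \<Otimes>\<^sub>M moves_space) (count_space (sym_grp n))"
    using measurable_cong_sets[OF refl] measurable_fst by blast
  then show ?case
    by (simp add: shuffle_walk.simps(1)[abs_def] eta_contract_eq)
next
  case (Suc t)
  have "sets move_measure = sets (count_space (skewed_moves n r))"
    by (simp add: sets_uniform_count_measure)
  then have snth: "(\<lambda>\<omega>. snd \<omega> !! t) \<in> measurable (\<mu> \<Otimes>\<^sub>M moves_space) (count_space (skewed_moves n r))"
    using measurable_cong_sets[OF refl] measurable_compose[OF measurable_snd measurable_snth] by blast
  \<comment> \<open>The next move takes finitely many values, so measurability for each fixed move
    \<open>d\<close> suffices.\<close>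
  have "(\<lambda>\<omega>. perm_mult (shuffle_walk t \<omega>) d) \<in> measurable (\<mu> \<Otimes>\<^sub>M moves_space) (count_space (sym_grp n))"
    if "d \<in> skewed_moves n r" for d
    using subsetD[OF skewed_moves_subset that]
    by (intro measurable_compose[OF Suc.IH]) (auto intro: perm_mult_in_sym_grp)
  then show ?case
    unfolding shuffle_walk.simps(2)
    by (rule measurable_compose_countable'[OF _ snth]) (auto simp: countable_finite finite_skewed_moves)
qed

definition type_path :: "(nat \<Rightarrow> nat) \<Rightarrow> nat \<Rightarrow> ((nat \<Rightarrow> nat) \<times> (nat \<Rightarrow> nat) stream) \<Rightarrow> bool" where
  "type_path s t \<omega> \<longleftrightarrow> (\<forall>i\<le>t. perm_type r (shuffle_walk i \<omega>) = s i)"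

lemma type_path_0: "type_path s 0 (g, \<omega>) \<longleftrightarrow> perm_type r g = s 0"
  by (simp add: type_path_def)

lemma type_path_Cons:
  "type_path s (Suc t) (g, d ## \<omega>) \<longleftrightarrow> perm_type r g = s 0 \<and> type_path (\<lambda>i. s (Suc i)) t (perm_mult g d, \<omega>)"
  unfolding type_path_def
  by (auto simp: All_less_Suc2 shuffle_walk_Cons simp del: shuffle_walk.simps(2) simp flip: less_Suc_eq_le)

lemma type_path_sets:
  assumes "sets \<mu> = Pow (sym_grp n)"
  shows "{\<omega> \<in> space (\<mu> \<Otimes>\<^sub>M moves_space). type_path s t \<omega>} \<in> sets (\<mu> \<Otimes>\<^sub>M moves_space)"
proof -
  have "(\<lambda>\<omega>. perm_type r (shuffle_walk i \<omega>) = s i) \<in> measurable (\<mu> \<Otimes>\<^sub>M moves_space) (count_space UNIV)" for i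
    by (rule measurable_compose[OF measurable_shuffle_walk[OF assms]]) simp
  then show ?thesis
    unfolding type_path_def by measurable
qed

lemma type_path_section_sets:
  assumes "g \<in> sym_grp n"
  shows "{\<omega> \<in> space moves_space. type_path s t (g, \<omega>)} \<in> sets moves_space"
proof -
  \<comment> \<open>\<open>count_space\<close> serves only as a measure with the right measurable
    sets, so that sections of a measurable set in a product can be taken.\<close>
  have "Pair g -` {\<omega> \<in> space (count_space (sym_grp n) \<Otimes>\<^sub>M moves_space). type_path s t \<omega>} \<in> sets moves_space"
    by (rule sets_Pair1[OF type_path_sets]) simp
  moreover have "Pair g -` {\<omega> \<in> space (count_space (sym_grp n) \<Otimes>\<^sub>M moves_space). type_path s t \<omega>}
      = {\<omega> \<in> space moves_space. type_path s t (g, \<omega>)}"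
    using assms by (auto simp: space_pair_measure)
  ultimately show ?thesis by simp
qed

text \<open>Condition on the first move: by \<open>skewed_moves_transition\<close> its chance of
  leading to type \<open>s 1\<close> depends on \<open>g\<close> only through the type of
  \<open>g\<close>. This is the lumpability behind the Markov property. Both \<open>g\<close> and
  \<open>s\<close> vary in the induction, as the rest of the path starts at \<open>gd\<close> with
  shifted types.\<close>

lemma emeasure_type_path_section:
  assumes "g \<in> sym_grp n" "\<And>i. i \<le> t \<Longrightarrow> s i \<le> r"
  shows "emeasure moves_space {\<omega> \<in> space moves_space. type_path s t (g, \<omega>)}
    = ennreal (of_bool (perm_type r g = s 0) * (\<Prod>i<t. Q $$ (s i, s (Suc i))))"
  using assms
proof (induction t arbitrary: g s)
  case 0
  interpret prob_space moves_space by (rule prob_space_moves_space)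
  show ?case
    by (simp add: type_path_0 emeasure_space_1)
next
  case (Suc t)
  let ?D = "skewed_moves n r" and ?P = "\<Prod>i<t. Q $$ (s (Suc i), s (Suc (Suc i)))"
  interpret stochastic_chain Q "Suc r" by (rule type_mat_stochastic[OF less])
  have Q_nonneg: "0 \<le> Q $$ (s i, s (Suc i))" if "i \<le> t" for i
    using that Suc.prems(2)[of i] Suc.prems(2)[of "Suc i"] by (intro nonneg) auto
  have P_nonneg: "0 \<le> ?P"
    by (intro prod_nonneg) (auto intro: Q_nonneg)
  have space: "d ## \<omega> \<in> space moves_space \<longleftrightarrow> d \<in> ?D \<and> \<omega> \<in> space moves_space" for d \<omega>
    by (simp add: stream_space_Stream space_uniform_count_measure)
  have IH: "emeasure moves_space {\<omega> \<in> space moves_space. type_path (\<lambda>i. s (Suc i)) t (perm_mult g d, \<omega>)}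
      = ennreal (of_bool (perm_type r (perm_mult g d) = s 1) * ?P)" if "d \<in> ?D" for d
  proof -
    have "perm_mult g d \<in> sym_grp n"
      using Suc.prems(1) subsetD[OF skewed_moves_subset that] by (rule perm_mult_in_sym_grp)
    then show ?thesis
      using Suc.IH[of "perm_mult g d" "\<lambda>i. s (Suc i)"] Suc.prems(2) by simp
  qed
  have "emeasure moves_space {\<omega> \<in> space moves_space. type_path s (Suc t) (g, \<omega>)}
      = (\<integral>\<^sup>+d. emeasure moves_space {\<omega> \<in> space moves_space.
          d ## \<omega> \<in> {\<omega> \<in> space moves_space. type_path s (Suc t) (g, \<omega>)}} \<partial>move_measure)"
    using Suc.prems(1) by (intro prob_space.emeasure_stream_space[OF prob_space_moves] type_path_section_sets)
  also have "\<dots> = (\<Sum>d\<in>?D. ennreal (1 / real (card ?D)) * emeasure moves_space {\<omega> \<in> space moves_space.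
          d ## \<omega> \<in> {\<omega> \<in> space moves_space. type_path s (Suc t) (g, \<omega>)}})"
    unfolding uniform_count_measure_def
    by (subst nn_integral_point_measure_finite) (auto simp: finite_skewed_moves)
  also have "\<dots> = (\<Sum>d\<in>?D. ennreal (of_bool (perm_type r g = s 0) * ?P / real (card ?D)
          * of_bool (perm_type r (perm_mult g d) = s 1)))"
  proof (intro sum.cong refl)
    fix d assume d: "d \<in> ?D"
    then have "{\<omega> \<in> space moves_space. d ## \<omega> \<in> {\<omega> \<in> space moves_space. type_path s (Suc t) (g, \<omega>)}}
       = (if perm_type r g = s 0
          then {\<omega> \<in> space moves_space. type_path (\<lambda>i. s (Suc i)) t (perm_mult g d, \<omega>)} else {})"
      by (auto simp: space type_path_Cons)
    then show "ennreal (1 / real (card ?D)) * emeasure moves_space {\<omega> \<in> space moves_space.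
          d ## \<omega> \<in> {\<omega> \<in> space moves_space. type_path s (Suc t) (g, \<omega>)}}
        = ennreal (of_bool (perm_type r g = s 0) * ?P / real (card ?D)
          * of_bool (perm_type r (perm_mult g d) = s 1))"
      using IH[OF d] by (simp flip: ennreal_mult')
  qed
  also have "\<dots> = ennreal (\<Sum>d\<in>?D. of_bool (perm_type r g = s 0) * ?P / real (card ?D)
          * of_bool (perm_type r (perm_mult g d) = s 1))"
    using P_nonneg by (intro sum_ennreal) auto
  also have "(\<Sum>d\<in>?D. of_bool (perm_type r g = s 0) * ?P / real (card ?D)
          * of_bool (perm_type r (perm_mult g d) = s 1))
      = of_bool (perm_type r g = s 0) * ?P
          * (real (card {d \<in> ?D. perm_type r (perm_mult g d) = s 1}) / real (card ?D))"
    by (subst sum_distrib_left[symmetric]) (simp add: finite_skewed_moves Int_def)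
  also have "\<dots> = of_bool (perm_type r g = s 0) * ?P * Q $$ (perm_type r g, s 1)"
    using skewed_moves_transition[OF less Suc.prems(1), of "s 1"] Suc.prems(2)[of 1] by simp
  \<comment> \<open>The indicator allows \<open>perm_type r g\<close> to be replaced by
    \<open>s 0\<close>, which supplies the factor for \<open>i = 0\<close>.\<close>
  also have "\<dots> = of_bool (perm_type r g = s 0) * (\<Prod>i<Suc t. Q $$ (s i, s (Suc i)))"
    by (simp add: prod.lessThan_Suc_shift del: prod.lessThan_Suc)
  finally show ?case .
qed

lemma prob_space_shuffle:
  assumes "prob_space \<mu>"
  shows "prob_space (shuffle_space n r \<mu>)"
proof -
  interpret M: prob_space \<mu> by fact
  interpret S: prob_space moves_space by (rule prob_space_moves_space)
  interpret pair_prob_space \<mu> moves_space ..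
  show ?thesis
    unfolding shuffle_space_def by (rule prob_space_axioms)
qed

text \<open>Integrates the previous formula over the starting permutation. The initial law enters
  only through the first factor, which cancels in conditional probabilities.\<close>

lemma prob_type_path:
  assumes \<mu>: "prob_space \<mu>" "sets \<mu> = Pow (sym_grp n)" and s: "\<And>i. i \<le> t \<Longrightarrow> s i \<le> r"
  shows "\<P>(\<omega> in shuffle_space n r \<mu>. type_path s t \<omega>)
    = measure \<mu> {g \<in> sym_grp n. perm_type r g = s 0} * (\<Prod>i<t. Q $$ (s i, s (Suc i)))"
proof -
  interpret M: prob_space \<mu> by fact
  interpret S: prob_space moves_space by (rule prob_space_moves_space)
  interpret stochastic_chain Q "Suc r" by (rule type_mat_stochastic[OF less])
  let ?P = "\<Prod>i<t. Q $$ (s i, s (Suc i))" and ?A = "{g \<in> sym_grp n. perm_type r g = s 0}"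
  have space: "space \<mu> = sym_grp n"
    using sets_eq_imp_space_eq[of \<mu> "count_space (sym_grp n)"] \<mu> by simp
  have P_nonneg: "0 \<le> ?P"
    using s by (intro prod_nonneg nonneg) (auto simp: less_Suc_eq_le)
  have "emeasure (\<mu> \<Otimes>\<^sub>M moves_space) {\<omega> \<in> space (\<mu> \<Otimes>\<^sub>M moves_space). type_path s t \<omega>}
     = (\<integral>\<^sup>+g. emeasure moves_space (Pair g -` {\<omega> \<in> space (\<mu> \<Otimes>\<^sub>M moves_space). type_path s t \<omega>}) \<partial>\<mu>)"
    by (rule S.emeasure_pair_measure_alt[OF type_path_sets[OF \<mu>(2)]])
  also have "\<dots> = (\<integral>\<^sup>+g. ennreal ?P * indicator ?A g \<partial>\<mu>)"
  proof (rule nn_integral_cong)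
    fix g assume g: "g \<in> space \<mu>"
    then have "Pair g -` {\<omega> \<in> space (\<mu> \<Otimes>\<^sub>M moves_space). type_path s t \<omega>}
        = {\<omega> \<in> space moves_space. type_path s t (g, \<omega>)}"
      by (auto simp: space_pair_measure)
    then show "emeasure moves_space (Pair g -` {\<omega> \<in> space (\<mu> \<Otimes>\<^sub>M moves_space). type_path s t \<omega>})
        = ennreal ?P * indicator ?A g"
      using emeasure_type_path_section[of g t s] s g by (auto simp: space split: split_indicator)
  qed
  also have "\<dots> = ennreal ?P * emeasure \<mu> ?A"
    by (rule nn_integral_cmult_indicator) (auto simp: \<mu>)
  also have "\<dots> = ennreal (measure \<mu> ?A * ?P)"
    using P_nonneg by (simp add: M.emeasure_eq_measure mult.commute flip: ennreal_mult')
  finally show ?thesis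
    using P_nonneg by (simp add: shuffle_space_def measure_def)
qed

theorem markov_chain_double_cosets:
  assumes \<mu>: "prob_space \<mu>" "sets \<mu> = Pow (sym_grp n)"
  shows "markov_chain (shuffle_space n r \<mu>) (double_cosets n r)
    (\<lambda>C C'. Q $$ (coset_type r C, coset_type r C'))
    (\<lambda>t \<omega>. double_coset n r (shuffle_walk t \<omega>))"
  unfolding markov_chain_def
proof (intro conjI allI ballI impI)
  let ?M = "shuffle_space n r \<mu>"
  interpret stochastic_chain Q "Suc r" by (rule type_mat_stochastic[OF less])
  have r: "r \<le> n" using less by simp
  have bij: "bij_betw (coset_type r) (double_cosets n r) {0..r}"
    using less by (intro bij_betw_coset_type) simp
  have type_le: "coset_type r C \<le> r" if "C \<in> double_cosets n r" for C
    using bij that by (auto simp: bij_betw_def)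
  have walk: "shuffle_walk t \<in> measurable ?M (count_space (sym_grp n))" for t
    unfolding shuffle_space_def by (rule measurable_shuffle_walk[OF \<mu>(2)])
  show "prob_space ?M"
    by (rule prob_space_shuffle[OF \<mu>(1)])
  show "finite (double_cosets n r)"
    by (simp add: double_cosets_def finite_sym_grp)
  show "(\<lambda>\<omega>. double_coset n r (shuffle_walk t \<omega>)) \<in> measurable ?M (count_space (double_cosets n r))" for t
    by (rule measurable_compose[OF walk]) (auto simp: double_cosets_def)
  show "0 \<le> Q $$ (coset_type r C, coset_type r C')"
    if "C \<in> double_cosets n r" "C' \<in> double_cosets n r" for C C'
    using type_le[OF that(1)] type_le[OF that(2)] by (intro nonneg) auto
  show "(\<Sum>C'\<in>double_cosets n r. Q $$ (coset_type r C, coset_type r C')) = 1"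
    if "C \<in> double_cosets n r" for C
  proof -
    have "(\<Sum>C'\<in>double_cosets n r. Q $$ (coset_type r C, coset_type r C'))
        = (\<Sum>y\<in>{0..r}. Q $$ (coset_type r C, y))"
      by (rule sum.reindex_bij_betw[OF bij])
    also have "{0..r} = {..<Suc r}" by auto
    finally show ?thesis
      using row_sum[of "coset_type r C"] type_le[OF that] by simp
  qed
  fix t s
  assume s: "\<forall>i\<le>Suc t. s i \<in> double_cosets n r"
    and nz: "\<P>(\<omega> in ?M. \<forall>i\<le>t. double_coset n r (shuffle_walk i \<omega>) = s i) \<noteq> 0"
  \<comment> \<open>Translates events about double cosets into events about types; outcomes in the
    space of the measure keep the walk inside \<open>sym_grp n\<close>.\<close>
  have coset_iff: "double_coset n r (shuffle_walk i \<omega>) = s i \<longleftrightarrow> perm_type r (shuffle_walk i \<omega>) = coset_type r (s i)"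
    if \<omega>: "\<omega> \<in> space ?M" and i: "i \<le> Suc t" for i \<omega>
  proof -
    have "shuffle_walk i \<omega> \<in> sym_grp n"
      using measurable_space[OF walk \<omega>] by simp
    moreover obtain h where "h \<in> sym_grp n" "s i = double_coset n r h"
      using s i by (auto simp: double_cosets_def)
    ultimately show ?thesis
      using r by (simp add: double_coset_eq_iff coset_type_double_coset)
  qed
  have path: "\<P>(\<omega> in ?M. \<forall>i\<le>u. double_coset n r (shuffle_walk i \<omega>) = s i)
      = \<P>(\<omega> in ?M. type_path (coset_type r \<circ> s) u \<omega>)" if "u \<le> Suc t" for u
  proof -
    have "(\<forall>i\<le>u. double_coset n r (shuffle_walk i \<omega>) = s i) \<longleftrightarrow> type_path (coset_type r \<circ> s) u \<omega>"
      if "\<omega> \<in> space ?M" for \<omega>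
      unfolding type_path_def comp_apply using coset_iff[OF that] \<open>u \<le> Suc t\<close>
      by (meson order_trans)
    then show ?thesis
      by (intro arg_cong[where f = "measure ?M"] Collect_cong) blast
  qed
  have prob: "\<P>(\<omega> in ?M. type_path (coset_type r \<circ> s) u \<omega>)
      = measure \<mu> {g \<in> sym_grp n. perm_type r g = coset_type r (s 0)}
        * (\<Prod>i<u. Q $$ (coset_type r (s i), coset_type r (s (Suc i))))" if "u \<le> Suc t" for u
    using prob_type_path[OF \<mu>, of u "coset_type r \<circ> s"] type_le s that by auto
  \<comment> \<open>The joint event is the path event up to \<open>Suc t\<close>, whose product
    formula has exactly one factor more than that of the conditioning event.\<close>
  have "\<P>(\<omega> in ?M. double_coset n r (shuffle_walk (Suc t) \<omega>) = s (Suc t)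
        \<and> (\<forall>i\<le>t. double_coset n r (shuffle_walk i \<omega>) = s i))
      = \<P>(\<omega> in ?M. \<forall>i\<le>Suc t. double_coset n r (shuffle_walk i \<omega>) = s i)"
    by (intro arg_cong[where f = "measure ?M"] Collect_cong) (auto simp: le_Suc_eq)
  also have "\<dots> = \<P>(\<omega> in ?M. \<forall>i\<le>t. double_coset n r (shuffle_walk i \<omega>) = s i)
      * Q $$ (coset_type r (s t), coset_type r (s (Suc t)))"
    by (simp add: path prob)
  finally show "\<P>(\<omega> in ?M. double_coset n r (shuffle_walk (Suc t) \<omega>) = s (Suc t)
        \<bar> \<forall>i\<le>t. double_coset n r (shuffle_walk i \<omega>) = s i)
      = Q $$ (coset_type r (s t), coset_type r (s (Suc t)))"
    using nz by (simp add: cond_prob_def)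
qed

end

text \<open>The substitution \<open>k = r - x\<close> permutes \<open>{0..r}\<close>, and the
  binomial coefficient of \<open>r\<close> is symmetric under it.\<close>

lemma type_eigenvalues_reflect:
  "image_mset (type_eigenvalue n r) (mset_set {0..r})
    = image_mset (\<lambda>x. (-1) ^ (r - x) * real (r choose x) / real ((n - r) choose (r - x))) (mset_set {0..r})"
proof -
  have inj: "inj_on (\<lambda>x. r - x) {0..r}"
    by (auto simp: inj_on_def)
  have "(\<lambda>x. r - x) ` {0..r} = {0..r}"
  proof (intro Set.equalityI subsetI)
    fix x assume "x \<in> {0..r}"
    then have "x = r - (r - x)" "r - x \<in> {0..r}" by auto
    then show "x \<in> (\<lambda>x. r - x) ` {0..r}" by (rule image_eqI)
  qed auto
  then have "mset_set {0..r} = image_mset (\<lambda>x. r - x) (mset_set {0..r})"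
    using image_mset_mset_set[OF inj] by simp
  then have "image_mset (type_eigenvalue n r) (mset_set {0..r})
      = image_mset (type_eigenvalue n r) (image_mset (\<lambda>x. r - x) (mset_set {0..r}))"
    by (rule arg_cong)
  also have "\<dots> = image_mset (\<lambda>x. (-1) ^ (r - x) * real (r choose x) / real ((n - r) choose (r - x))) (mset_set {0..r})"
    unfolding image_mset.compositionality comp_def
    by (intro image_mset_cong) (auto simp: type_eigenvalue_def simp flip: binomial_symmetric)
  finally show ?thesis .
qed

theorem mainTheorem5:
  fixes n r :: nat
  assumes "n > 2 * r"
  shows "bij_betw (coset_type r) (double_cosets n r) {0..r} \<and>
    (\<forall>g \<in> sym_grp n. coset_type r (double_coset n r g) = perm_type r g) \<and>
    (\<exists>Q \<in> carrier_mat (Suc r) (Suc r).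
      (\<forall>\<mu>. prob_space \<mu> \<and> sets \<mu> = Pow (sym_grp n) \<longrightarrow>
        markov_chain (shuffle_space n r \<mu>) (double_cosets n r)
          (\<lambda>C C'. Q $$ (coset_type r C, coset_type r C'))
          (\<lambda>t \<omega>. double_coset n r (shuffle_walk t \<omega>))) \<and>
      irreducible_chain Q \<and> recurrent_chain Q \<and> reversible_chain Q \<and> ergodic_chain Q \<and>
      anti_diagonal_eigenvalue_property r Q \<and>
      eigenvalue_mset Q =
        image_mset (\<lambda>x. (-1) ^ (r - x) * real (r choose x) / real ((n - r) choose (r - x)))
          (mset_set {0..r}) \<and>
      (\<exists>!p. invariant_distribution Q p) \<and>
      (\<forall>p. invariant_distribution Q p \<longrightarrow>
        (\<forall>x \<le> r. vec_index p (r - x) =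
          real ((r choose (r - x)) * ((n - r) choose x)) / real (n choose r))) \<and>
      (r \<ge> 1 \<longrightarrow> second_largest_abs_eigenvalue Q (- (real r / real (n - r)))))"
proof -
  interpret skewed_shuffle n r
    by unfold_locales (rule assms)
  interpret positive_power_chain Q "Suc r" "Suc (2 * r)"
    by (rule type_mat_positive_power[OF less])
  have pos: "0 < vec_index (type_dist n r) x" if "x < Suc r" for x
    using that less by (auto simp: type_dist_index less_Suc_eq_le)
  have unique: "p = type_dist n r" if "invariant_distribution Q p" for p
    using invariant_distribution_unique[OF type_dist_invariant[OF less] that pos] .
  \<comment> \<open>Evaluated at type \<open>r - x\<close>, so that \<open>x\<close> counts the
    points of \<open>{1..r}\<close> sent outside \<open>{1..r}\<close>.\<close>
  have dist: "vec_index (type_dist n r) (r - x)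
      = real ((r choose (r - x)) * ((n - r) choose x)) / real (n choose r)" if "x \<le> r" for x
    using that by (simp add: type_dist_index)
  show ?thesis
  proof (intro conjI bexI[of _ Q] ballI allI impI)
    show "bij_betw (coset_type r) (double_cosets n r) {0..r}"
      using less by (intro bij_betw_coset_type) simp
    show "coset_type r (double_coset n r g) = perm_type r g" if "g \<in> sym_grp n" for g
      using less that by (intro coset_type_double_coset) auto
    show "markov_chain (shuffle_space n r \<mu>) (double_cosets n r)
        (\<lambda>C C'. Q $$ (coset_type r C, coset_type r C'))
        (\<lambda>t \<omega>. double_coset n r (shuffle_walk t \<omega>))"
      if "prob_space \<mu> \<and> sets \<mu> = Pow (sym_grp n)" for \<mu>
      using that by (intro markov_chain_double_cosets) auto
    show "reversible_chain Q"
      using type_dist_invariant[OF less] type_mat_detailed_balance[OF less]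
      by (auto simp: reversible_chain_def)
    show "\<exists>!p. invariant_distribution Q p"
      using type_dist_invariant[OF less] unique by blast
    show "vec_index p (r - x) = real ((r choose (r - x)) * ((n - r) choose x)) / real (n choose r)"
      if "invariant_distribution Q p" "x \<le> r" for p x
      using dist[OF that(2)] unique[OF that(1)] by simp
    show "eigenvalue_mset Q = image_mset (\<lambda>x. (-1) ^ (r - x) * real (r choose x)
        / real ((n - r) choose (r - x))) (mset_set {0..r})"
      by (simp only: type_mat_eigenvalues[OF less] type_eigenvalues_reflect)
    show "second_largest_abs_eigenvalue Q (- (real r / real (n - r)))" if "1 \<le> r"
      by (rule type_mat_second_largest_eigenvalue[OF less that])
  qed (use less in \<open>simp_all add: irreducible recurrent_chain ergodic_chain type_mat_anti_diagonal\<close>)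
qed

end
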